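(* Consider the grouped linear model $Y=X\beta+\varepsilon$ with errors $\varepsilon_1,\dots,\varepsilon_n$ i.i.d. $N(0,\sigma^2)$. Let $\{\bar c,\sigma,r_1,r_2,c_0,d\}$ be fixed and $1\le q\le n\le p\to\infty$. Suppose that the generalized sparsity condition $\sum_{k=q+1}^{p}\|\beta_k\|_2\le \eta_1$ holds, that $X$ satisfies the sparse Riesz condition with rank $q^*$ and spectrum bounds $0<c_*<c^*<\infty$, and that $\lambda\ge\max\{\lambda_0,\lambda_{n,p}\}$. Let $\hat\beta$ be the group Lasso estimator with penalty level $\lambda$. Then, with probability converging to $1$, $$\|\hat\beta-\beta\|_2\le\frac{1}{\sqrt{nc_*}}\Big(2\sigma\sqrt{M_1\log(N_d)\,q}+\big(r_2+\sqrt{dM_1\bar c}\big)B_1\Big)+\sqrt{\frac{c_*r_1^2+r_2^2}{c_*c^*}}\;\frac{\sqrt q\,\lambda}{n}$$ and $$\|X\hat\beta-X\beta\|_2\le 2\sigma\sqrt{M_1\log(N_d)\,q}+\big(2r_2+\sqrt{dM_1\bar c}\big)B_1,$$ where $M_1=M_1(\lambda)$ and $B_1=B_1(\lambda)=\big((\lambda^2d_b^2q)/(nc^* )\big)^{1/2}$.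
   Context: Model: there are $p$ groups; $X=(X_1,\dots,X_p)$ where $X_k$ is an $n\times d_k$ (non-random) covariate matrix, $\beta=(\beta_1',\dots,\beta_p')'$ with $\beta_k\in\mathbb R^{d_k}$, $\varepsilon=(\varepsilon_1,\dots,\varepsilon_n)'$, and $Y=X\beta+\varepsilon\in\mathbb R^n$. Quantities not declared fixed may vary along the sequence of models. Group Lasso: for $\lambda\ge0$, $$\hat\beta=(\hat\beta_1',\dots,\hat\beta_p')'=\arg\min_\beta \tfrac12 (Y-X\beta)'(Y-X\beta)+\lambda\sum_{k=1}^p\sqrt{d_k}\,\|\beta_k\|_2 .$$ Sparsity: $A_0=\{q+1,\dots,p\}$, and the generalized sparsity condition is $\sum_{k\in A_0}\|\beta_k\|_2\le\eta_1$ for some $\eta_1\ge0$. Set $\eta_2=\max_{A\subset A_0}\|\sum_{k\in A}X_k\beta_k\|_2$. Sparse Riesz condition (SRC) with rank $q^*$ and spectrum bounds $0<c_*<c^*<\infty$: for every $A\subset\{1,\dots,p\}$ with $|A|=\#\{k:k\in A\}=q^*$ and every nonzero $\nu\in\mathbb R^{\sum_{k\in A}d_k}$, $c_*\le \|X_A\nu\|_2^2/(n\|\nu\|_2^2)\le c^*$, where $X_A=(X_k,k\in A)$. Constants: $d_a=\max_{1\le k\le p}d_k$, $d_b=\min_{1\le k\le p}d_k$, $d=d_a/d_b$, $N_d=\sum_{k=1}^pd_k$, $\bar c=c^*/c_*$, $$r_1=r_1(\lambda)=\Big(\frac{nc^*\sqrt{d_a}\,\eta_1}{\lambda d_bq}\Big)^{1/2},\qquad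 r_2=r_2(\lambda)=\Big(\frac{nc^*\eta_2^2}{\lambda^2d_bq}\Big)^{1/2},$$ $$M_1(\lambda)=2+4r_1^2+4\sqrt{d\bar c}\,r_2+4d\bar c.$$ Penalty levels: $\lambda_{n,p}=2\sigma\sqrt{8(1+c_0)d_ad^2q^*\bar c\,nc^*\log(N_d\vee a_n)}$, where $c_0\ge0$ and $a_n\ge0$ satisfy $pd_a/(N_d\vee a_n)^{1+c_0}\to0$ (for $p\to\infty$ one may take $a_n=0$); $\lambda_0=\inf\{\lambda: M_1(\lambda)q+1\le q^*\}$, with $\inf\varnothing=\infty$. *)

theory Defs
  imports "HOL-Probability.Probability"
begin

text \<open>
  One grouped linear model.  Observations, groups and the coordinates inside a group are
  numbered from 1.  A grouped vector \<open>(\<nu>\<^sub>1', \<dots>, \<nu>\<^sub>p')'\<close> is a function \<open>\<nu>\<close> with \<open>\<nu> k j\<close> the \<open>j\<close>-th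
  coordinate of its \<open>k\<close>-th block, and \<open>design i k j\<close> is the entry of the block \<open>X\<^sub>k\<close> in row \<open>i\<close>
  and column \<open>j\<close>.  Values outside the index ranges are junk and are never inspected.
\<close>

record grouped_model =
  nobs :: nat        \<comment> \<open>\<open>n\<close>\<close>
  ngrp :: nat        \<comment> \<open>\<open>p\<close>\<close>
  gdim :: "nat \<Rightarrow> nat"        \<comment> \<open>\<open>d\<^sub>k\<close>\<close>
  design :: "nat \<Rightarrow> nat \<Rightarrow> nat \<Rightarrow> real"        \<comment> \<open>\<open>X\<close>\<close>
  coeff_true :: "nat \<Rightarrow> nat \<Rightarrow> real"        \<comment> \<open>\<open>\<beta>\<close>\<close>
  nlarge :: nat        \<comment> \<open>\<open>q\<close>\<close>
  eta1 :: real        \<comment> \<open>\<open>\<eta>\<^sub>1\<close>\<close>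
  rank_src :: nat        \<comment> \<open>\<open>q\<^sup>*\<close>\<close>
  spec_lo :: real        \<comment> \<open>\<open>c\<^sub>*\<close>\<close>
  spec_hi :: real        \<comment> \<open>\<open>c\<^sup>*\<close>\<close>

definition obs_norm :: "grouped_model \<Rightarrow> (nat \<Rightarrow> real) \<Rightarrow> real" where
  "obs_norm G y = L2_set y {1..nobs G}"

definition block_norm :: "grouped_model \<Rightarrow> nat \<Rightarrow> (nat \<Rightarrow> nat \<Rightarrow> real) \<Rightarrow> real" where
  "block_norm G k \<nu> = L2_set (\<nu> k) {1..gdim G k}"

definition coeff_index :: "grouped_model \<Rightarrow> nat set \<Rightarrow> (nat \<times> nat) set" where
  "coeff_index G A = (SIGMA k:A. {1..gdim G k})"

definition coeff_norm :: "grouped_model \<Rightarrow> nat set \<Rightarrow> (nat \<Rightarrow> nat \<Rightarrow> real) \<Rightarrow> real" where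
  "coeff_norm G A \<nu> = L2_set (\<lambda>(k, j). \<nu> k j) (coeff_index G A)"

text \<open>The vector \<open>X\<^sub>A \<nu> = (\<Sum>k\<in>A. X\<^sub>k \<nu>\<^sub>k)\<close>.\<close>

definition lin_map :: "grouped_model \<Rightarrow> nat set \<Rightarrow> (nat \<Rightarrow> nat \<Rightarrow> real) \<Rightarrow> nat \<Rightarrow> real" where
  "lin_map G A \<nu> = (\<lambda>i. \<Sum>k\<in>A. \<Sum>j\<in>{1..gdim G k}. design G i k j * \<nu> k j)"

definition group_lasso_objective ::
    "grouped_model \<Rightarrow> real \<Rightarrow> (nat \<Rightarrow> real) \<Rightarrow> (nat \<Rightarrow> nat \<Rightarrow> real) \<Rightarrow> real" where
  "group_lasso_objective G lam y b =
     1 / 2 * (\<Sum>i\<in>{1..nobs G}. (y i - lin_map G {1..ngrp G} b i)\<^sup>2)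
     + lam * (\<Sum>k\<in>{1..ngrp G}. sqrt (real (gdim G k)) * block_norm G k b)"

text \<open>The minimiser need not be unique when \<open>n \<le> p\<close>; any one of them counts as a solution.\<close>

definition is_group_lasso ::
    "grouped_model \<Rightarrow> real \<Rightarrow> (nat \<Rightarrow> real) \<Rightarrow> (nat \<Rightarrow> nat \<Rightarrow> real) \<Rightarrow> bool" where
  "is_group_lasso G lam y b \<longleftrightarrow> is_arg_min (group_lasso_objective G lam y) (\<lambda>_. True) b"

definition small_groups :: "grouped_model \<Rightarrow> nat set" where
  "small_groups G = {nlarge G + 1..ngrp G}"

definition generalized_sparsity :: "grouped_model \<Rightarrow> bool" where
  "generalized_sparsity G \<longleftrightarrow>
     0 \<le> eta1 G \<and> (\<Sum>k\<in>small_groups G. block_norm G k (coeff_true G)) \<le> eta1 G"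

definition eta2 :: "grouped_model \<Rightarrow> real" where
  "eta2 G = Max ((\<lambda>A. obs_norm G (lin_map G A (coeff_true G))) ` Pow (small_groups G))"

text \<open>
  The requirement \<open>q\<^sup>* \<le> p\<close> is implicit in speaking of sets of \<open>q\<^sup>*\<close> groups: without it the
  condition would be vacuous.
\<close>

definition sparse_riesz :: "grouped_model \<Rightarrow> bool" where
  "sparse_riesz G \<longleftrightarrow>
     0 < spec_lo G \<and> spec_lo G < spec_hi G \<and> rank_src G \<le> ngrp G \<and>
     (\<forall>A \<nu>. A \<subseteq> {1..ngrp G} \<and> card A = rank_src G \<and> (\<exists>(k, j)\<in>coeff_index G A. \<nu> k j \<noteq> 0) \<longrightarrow>
        spec_lo G \<le> (obs_norm G (lin_map G A \<nu>))\<^sup>2 / (real (nobs G) * (coeff_norm G A \<nu>)\<^sup>2) \<and>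
        (obs_norm G (lin_map G A \<nu>))\<^sup>2 / (real (nobs G) * (coeff_norm G A \<nu>)\<^sup>2) \<le> spec_hi G)"

definition dim_a :: "grouped_model \<Rightarrow> nat" where
  "dim_a G = Max (gdim G ` {1..ngrp G})"

definition dim_b :: "grouped_model \<Rightarrow> nat" where
  "dim_b G = Min (gdim G ` {1..ngrp G})"

definition dim_ratio :: "grouped_model \<Rightarrow> real" where
  "dim_ratio G = real (dim_a G) / real (dim_b G)"

definition dim_total :: "grouped_model \<Rightarrow> nat" where
  "dim_total G = (\<Sum>k\<in>{1..ngrp G}. gdim G k)"

definition spec_ratio :: "grouped_model \<Rightarrow> real" where
  "spec_ratio G = spec_hi G / spec_lo G"

definition r1 :: "grouped_model \<Rightarrow> real \<Rightarrow> real" where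
  "r1 G lam = sqrt (real (nobs G) * spec_hi G * sqrt (real (dim_a G)) * eta1 G
                    / (lam * real (dim_b G) * real (nlarge G)))"

definition r2 :: "grouped_model \<Rightarrow> real \<Rightarrow> real" where
  "r2 G lam = sqrt (real (nobs G) * spec_hi G * (eta2 G)\<^sup>2
                    / (lam\<^sup>2 * real (dim_b G) * real (nlarge G)))"

definition M1 :: "grouped_model \<Rightarrow> real \<Rightarrow> real" where
  "M1 G lam = 2 + 4 * (r1 G lam)\<^sup>2 + 4 * sqrt (dim_ratio G * spec_ratio G) * r2 G lam
              + 4 * dim_ratio G * spec_ratio G"

definition B1 :: "grouped_model \<Rightarrow> real \<Rightarrow> real" where
  "B1 G lam = sqrt (lam\<^sup>2 * (real (dim_b G))\<^sup>2 * real (nlarge G) / (real (nobs G) * spec_hi G))"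

text \<open>The penalty level \<open>\<lambda>\<^sub>n\<^sub>,\<^sub>p\<close>, with noise level \<open>\<sigma>\<close> and constants \<open>c\<^sub>0\<close> and \<open>a = a\<^sub>n\<close>.\<close>

definition lambda_np :: "grouped_model \<Rightarrow> real \<Rightarrow> real \<Rightarrow> real \<Rightarrow> real" where
  "lambda_np G \<sigma> c0 a =
     2 * \<sigma> * sqrt (8 * (1 + c0) * real (dim_a G) * (dim_ratio G)\<^sup>2 * real (rank_src G)
                   * spec_ratio G * real (nobs G) * spec_hi G * ln (max (real (dim_total G)) a))"

text \<open>
  The infimum is taken in the extended reals, where \<open>Inf {} = \<infinity>\<close>.  Only \<open>\<lambda> > 0\<close> is considered,
  because \<open>r\<^sub>1(\<lambda>)\<close> and \<open>r\<^sub>2(\<lambda>)\<close> have \<open>\<lambda>\<close> in the denominator and division by zero yields 0 in HOL.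
\<close>

definition lambda_0 :: "grouped_model \<Rightarrow> ereal" where
  "lambda_0 G =
     Inf (ereal ` {lam. 0 < lam \<and> M1 G lam * real (nlarge G) + 1 \<le> real (rank_src G)})"

end

theory Submission imports Defs begin

text \<open>
  Let \<open>h\<close> be the difference of the estimator and the true coefficient.  The proof consists of a
  deterministic argument on an event on which the noise is small, and a Gaussian estimate for the
  probability of that event.

  The event says that every column of the design has correlation at most \<open>\<lambda> / 10\<close> with the noise.
  The columns have norm at most \<open>\<surd>(n c\<^sup>*)\<close> by the sparse Riesz condition, so a Chernoff bound and a
  union bound over at most \<open>p d\<^sub>a\<close> columns show that all correlations stay below
  \<open>\<sigma> \<surd>(2 n c\<^sup>* (1 + c\<^sub>0) log (N\<^sub>d \<or> a\<^sub>n))\<close>, except with probability at most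
  \<open>2 p d\<^sub>a / (N\<^sub>d \<or> a\<^sub>n)\<^bsup>1 + c\<^sub>0\<^esup> \<longlonglongrightarrow> 0\<close> (\<open>noise_level_prob\<close>).  The choice of \<open>\<lambda>\<^sub>n\<^sub>,\<^sub>p\<close> makes this level at
  most \<open>\<lambda> / 10\<close> (\<open>noise_level_le_penalty\<close>).

  On the event, optimality of the estimator gives a cone inequality (\<open>lasso_cone_inequality\<close>):
  \<open>\<parallel>X h\<parallel>\<^sup>2\<close> plus the penalty of \<open>h\<close> on the small groups is, up to the factors \<open>9/10\<close> and \<open>11/10\<close>, at most
  the penalty of \<open>h\<close> on the \<open>q\<close> large groups plus \<open>2 \<lambda> \<surd>d\<^sub>a \<eta>\<^sub>1\<close>.  It is combined with a restricted
  eigenvalue bound (\<open>restricted_eigenvalue\<close>): the large groups together with the \<open>q\<^sup>* - q\<close> largest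
  blocks of \<open>h\<close> form a set to which the sparse Riesz condition applies, and the remaining blocks,
  peeled off in chunks of decreasing size, perturb this by an \<open>\<ell>\<^sub>1\<close>-norm divided by
  \<open>\<surd>(q\<^sup>* - q)\<close>.  Since \<open>\<lambda> \<ge> \<lambda>\<^sub>0\<close>, the rank satisfies \<open>q\<^sup>* - q \<ge> 4 (r\<^sub>1\<^sup>2 + D) q\<close> with \<open>D = d c\<^sup>* / c\<^sub>*\<close>, and
  the perturbation is absorbed by the penalty on the small groups (\<open>cone_arithmetic\<close>).

  The outcome (\<open>group_lasso_error_bounds\<close>) is that \<open>\<parallel>X h\<parallel>\<close> and \<open>\<surd>(n c\<^sub>*) \<parallel>h\<parallel>\<close> are both at most
  \<open>2 \<surd>(r\<^sub>1\<^sup>2 + D) \<lambda> \<surd>(d\<^sub>b q / (n c\<^sup>*))\<close>.  This is at most \<open>\<surd>(D M\<^sub>1) B\<^sub>1\<close> (\<open>error_radius_le\<close>), one of the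
  nonnegative terms in the claimed bounds.
\<close>

section \<open>Norms and the design map\<close>

lemma block_norm_nonneg: "0 \<le> block_norm G k v"
  by (simp add: block_norm_def)

lemma obs_norm_nonneg: "0 \<le> obs_norm G y"
  by (simp add: obs_norm_def)

lemma obs_norm_power2: "(obs_norm G y)\<^sup>2 = (\<Sum>i\<in>{1..nobs G}. (y i)\<^sup>2)"
  by (simp add: obs_norm_def L2_set_def sum_nonneg)

lemma block_norm_power2: "(block_norm G k v)\<^sup>2 = (\<Sum>j\<in>{1..gdim G k}. (v k j)\<^sup>2)"
  by (simp add: block_norm_def L2_set_def sum_nonneg)

lemma coeff_norm_nonneg: "0 \<le> coeff_norm G A v"
  by (simp add: coeff_norm_def)

lemma coeff_norm_power2:
  assumes "finite A"
  shows "(coeff_norm G A v)\<^sup>2 = (\<Sum>k\<in>A. (block_norm G k v)\<^sup>2)"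
proof -
  have "(coeff_norm G A v)\<^sup>2 = (\<Sum>(k, j)\<in>coeff_index G A. (v k j)\<^sup>2)"
    by (simp add: coeff_norm_def L2_set_def sum_nonneg case_prod_beta)
  also have "\<dots> = (\<Sum>k\<in>A. \<Sum>j\<in>{1..gdim G k}. (v k j)\<^sup>2)"
    unfolding coeff_index_def using assms by (subst sum.Sigma) auto
  finally show ?thesis
    by (simp add: block_norm_power2)
qed

lemma lin_map_Un:
  assumes "finite A" "finite B" "A \<inter> B = {}"
  shows "lin_map G (A \<union> B) v i = lin_map G A v i + lin_map G B v i"
  unfolding lin_map_def using assms by (rule sum.union_disjoint)

lemma lin_map_linear:
  "lin_map G A (\<lambda>k j. u k j + c * v k j) i = lin_map G A u i + c * lin_map G A v i"
  unfolding lin_map_def by (simp add: algebra_simps sum.distrib sum_distrib_left)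

lemma lin_map_diff:
  "lin_map G A (\<lambda>k j. u k j - v k j) i = lin_map G A u i - lin_map G A v i"
  unfolding lin_map_def by (simp add: algebra_simps sum_subtractf)

lemma block_norm_linear_le:
  assumes "0 \<le> c" "0 \<le> c'"
  shows "block_norm G k (\<lambda>k j. c * u k j + c' * v k j) \<le> c * block_norm G k u + c' * block_norm G k v"
proof -
  have "L2_set (\<lambda>j. c * u k j + c' * v k j) {1..gdim G k}
      \<le> L2_set (\<lambda>j. c * u k j) {1..gdim G k} + L2_set (\<lambda>j. c' * v k j) {1..gdim G k}"
    by (rule L2_set_triangle_ineq)
  then show ?thesis
    using assms by (simp add: block_norm_def L2_set_right_distrib)
qed

lemma block_norm_le_add_diff: "block_norm G k u \<le> block_norm G k v + block_norm G k (\<lambda>k j. v k j - u k j)"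
proof -
  have "L2_set (\<lambda>j. v k j + (-1) * (v k j - u k j)) {1..gdim G k}
     \<le> L2_set (v k) {1..gdim G k} + L2_set (\<lambda>j. (-1) * (v k j - u k j)) {1..gdim G k}"
    by (rule L2_set_triangle_ineq)
  moreover have "L2_set (\<lambda>j. (-1) * (v k j - u k j)) {1..gdim G k} = L2_set (\<lambda>j. v k j - u k j) {1..gdim G k}"
    by (simp add: L2_set_def power2_commute)
  ultimately show ?thesis
    by (simp add: block_norm_def)
qed

lemma block_norm_diff_le_add: "block_norm G k (\<lambda>k j. v k j - u k j) \<le> block_norm G k v + block_norm G k u"
  using block_norm_le_add_diff[of G k "\<lambda>k j. v k j - u k j" v] by simp

section \<open>Dimensions and ratios\<close>

lemma gdim_le_dim_a: "k \<in> {1..ngrp G} \<Longrightarrow> gdim G k \<le> dim_a G"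
  by (simp add: dim_a_def)

lemma dim_b_le_gdim: "k \<in> {1..ngrp G} \<Longrightarrow> dim_b G \<le> gdim G k"
  by (simp add: dim_b_def)

lemma dim_b_pos:
  assumes "1 \<le> ngrp G" "\<And>k. k \<in> {1..ngrp G} \<Longrightarrow> 1 \<le> gdim G k"
  shows "1 \<le> dim_b G"
  unfolding dim_b_def using assms by (subst Min_ge_iff) auto

lemma dim_b_le_dim_a: "1 \<le> ngrp G \<Longrightarrow> dim_b G \<le> dim_a G"
  using gdim_le_dim_a[of 1 G] dim_b_le_gdim[of 1 G] by simp

lemma r2_nonneg: "sparse_riesz G \<Longrightarrow> 0 \<le> r2 G lam"
  by (auto simp: r2_def sparse_riesz_def intro!: divide_nonneg_nonneg mult_nonneg_nonneg)

lemma spec_ratio_gt_1: "sparse_riesz G \<Longrightarrow> 1 < spec_ratio G"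
  by (auto simp: spec_ratio_def sparse_riesz_def)

lemma dim_ratio_ge_1:
  assumes "1 \<le> ngrp G" "\<And>k. k \<in> {1..ngrp G} \<Longrightarrow> 1 \<le> gdim G k"
  shows "1 \<le> dim_ratio G"
  using dim_b_pos[of G, OF assms] dim_b_le_dim_a[OF assms(1)] by (simp add: dim_ratio_def)

lemma M1_ge:
  assumes "sparse_riesz G" "0 \<le> dim_ratio G * spec_ratio G"
  shows "2 + 4 * (r1 G lam)\<^sup>2 + 4 * (dim_ratio G * spec_ratio G) \<le> M1 G lam"
  using r2_nonneg[OF assms(1), of lam] assms(2) by (simp add: M1_def)

section \<open>The basic inequality of the group Lasso\<close>

text \<open>
  Moving from a minimiser \<open>b\<close> a fraction \<open>t\<close> of the way towards the true coefficient cannot lower the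
  objective.  The penalty is convex and the loss is quadratic, so the change is at most
  \<open>t R + t\<^sup>2 Q\<close>, with \<open>R\<close> the right-hand side minus the left-hand side below; \<open>t \<rightarrow> 0\<close> gives \<open>R \<ge> 0\<close>.
  Comparing the objective at \<open>b\<close> and at the true coefficient only would lose a factor \<open>1/2\<close> in
  front of \<open>\<parallel>X h\<parallel>\<^sup>2\<close>.
\<close>

lemma lasso_basic_inequality:
  fixes G :: grouped_model and y e :: "nat \<Rightarrow> real" and b :: "nat \<Rightarrow> nat \<Rightarrow> real"
  defines "h \<equiv> \<lambda>k j. b k j - coeff_true G k j"
  assumes lasso: "is_group_lasso G lam y b" and lam: "0 \<le> lam"
    and y: "\<And>i. i \<in> {1..nobs G} \<Longrightarrow> y i = lin_map G {1..ngrp G} (coeff_true G) i + e i"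
  shows "(obs_norm G (lin_map G {1..ngrp G} h))\<^sup>2
      \<le> (\<Sum>i\<in>{1..nobs G}. e i * lin_map G {1..ngrp G} h i)
        + lam * (\<Sum>k\<in>{1..ngrp G}. sqrt (real (gdim G k)) * (block_norm G k (coeff_true G) - block_norm G k b))"
proof -
  let ?N = "{1..ngrp G}" and ?O = "{1..nobs G}"
  define l where "l = lin_map G ?N h"
  define pen where "pen v = (\<Sum>k\<in>?N. sqrt (real (gdim G k)) * block_norm G k v)" for v
  have l: "l i = lin_map G ?N b i - lin_map G ?N (coeff_true G) i" for i
    unfolding l_def h_def by (rule lin_map_diff)
  define R where "R = (\<Sum>i\<in>?O. (e i - l i) * l i) + lam * (pen (coeff_true G) - pen b)"
  define Q where "Q = (\<Sum>i\<in>?O. (l i)\<^sup>2) / 2"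
  have Q0: "0 \<le> Q" unfolding Q_def by (simp add: sum_nonneg)
  have step: "0 \<le> R + t * Q" if t: "0 < t" "t \<le> 1" for t
  proof -
    define b' where "b' = (\<lambda>k j. (1 - t) * b k j + t * coeff_true G k j)"
    have b'_alt: "b' = (\<lambda>k j. b k j + (- t) * h k j)"
      by (simp add: b'_def h_def algebra_simps fun_eq_iff)
    have "group_lasso_objective G lam y b \<le> group_lasso_objective G lam y b'"
      using lasso unfolding is_group_lasso_def is_arg_min_def by (meson linorder_not_le)
    moreover have "pen b' \<le> (1 - t) * pen b + t * pen (coeff_true G)"
    proof -
      have "pen b' \<le> (\<Sum>k\<in>?N. sqrt (real (gdim G k)) *
                ((1 - t) * block_norm G k b + t * block_norm G k (coeff_true G)))"
        unfolding pen_def b'_def using t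
        by (intro sum_mono mult_left_mono block_norm_linear_le) auto
      also have "\<dots> = (1 - t) * pen b + t * pen (coeff_true G)"
        by (simp add: pen_def sum_distrib_left sum.distrib[symmetric] algebra_simps)
      finally show ?thesis .
    qed
    then have "lam * pen b' \<le> lam * ((1 - t) * pen b + t * pen (coeff_true G))"
      using lam by (rule mult_left_mono)
    moreover have "(\<Sum>i\<in>?O. (y i - lin_map G ?N b' i)\<^sup>2)
      = (\<Sum>i\<in>?O. (y i - lin_map G ?N b i)\<^sup>2) + 2 * t * (\<Sum>i\<in>?O. (e i - l i) * l i) + t\<^sup>2 * (\<Sum>i\<in>?O. (l i)\<^sup>2)"
    proof -
      have "(y i - lin_map G ?N b' i)\<^sup>2
          = (y i - lin_map G ?N b i)\<^sup>2 + 2 * t * ((e i - l i) * l i) + t\<^sup>2 * (l i)\<^sup>2"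
        if "i \<in> ?O" for i
      proof -
        have "y i - lin_map G ?N b i = e i - l i" using y[OF that] l by simp
        moreover have "lin_map G ?N b' i = lin_map G ?N b i + (- t) * l i"
          unfolding b'_alt l_def by (rule lin_map_linear)
        ultimately have "y i - lin_map G ?N b' i = (e i - l i) + t * l i" by simp
        then show ?thesis using \<open>y i - lin_map G ?N b i = e i - l i\<close>
          by (simp only:) (simp add: power2_eq_square algebra_simps)
      qed
      then have "(\<Sum>i\<in>?O. (y i - lin_map G ?N b' i)\<^sup>2)
         = (\<Sum>i\<in>?O. (y i - lin_map G ?N b i)\<^sup>2 + 2 * t * ((e i - l i) * l i) + t\<^sup>2 * (l i)\<^sup>2)"
        by (rule sum.cong[OF refl])
      then show ?thesis by (simp add: sum.distrib sum_distrib_left)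
    qed
    ultimately have "0 \<le> t * R + t\<^sup>2 * Q"
      unfolding group_lasso_objective_def pen_def[symmetric] R_def Q_def
      by (simp add: field_simps)
    then have "0 \<le> t * (R + t * Q)" by (simp add: power2_eq_square algebra_simps)
    then show ?thesis using t by (simp add: zero_le_mult_iff)
  qed
  have "0 \<le> R"
  proof (rule ccontr)
    assume "\<not> 0 \<le> R"
    \<comment> \<open>For this \<open>t\<close> the quadratic term makes up at most half of \<open>\<bar>R\<bar>\<close>.\<close>
    define t where "t = min 1 (- R / (2 * (Q + 1)))"
    have t: "0 < t" "t \<le> 1" using \<open>\<not> 0 \<le> R\<close> Q0 by (auto simp: t_def intro!: divide_neg_pos)
    have "t * Q \<le> - R / (2 * (Q + 1)) * (Q + 1)"
      using Q0 \<open>\<not> 0 \<le> R\<close> t by (intro mult_mono) (auto simp: t_def)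
    also have "\<dots> = - R / 2" using Q0 by (simp add: field_simps)
    finally show False using step[OF t] \<open>\<not> 0 \<le> R\<close> by simp
  qed
  then show ?thesis
    unfolding R_def pen_def obs_norm_power2 l_def[symmetric]
    by (simp add: algebra_simps sum_subtractf power2_eq_square sum_distrib_left)
qed

text \<open>
  After exchanging sums, \<open>\<epsilon>' X h\<close> pairs \<open>h\<close> with the correlations of the noise and the columns of
  \<open>X\<close>.  Inside a block the Cauchy-Schwarz inequality turns the sum of \<open>\<bar>h\<^sub>k\<^sub>j\<bar>\<close> into
  \<open>\<surd>d\<^sub>k \<parallel>h\<^sub>k\<parallel>\<close>, so the noise is measured in exactly the norm that the penalty uses.
\<close>

lemma noise_inner_product_le:
  assumes "\<And>k j. (k, j) \<in> coeff_index G {1..ngrp G} \<Longrightarrow> \<bar>\<Sum>i\<in>{1..nobs G}. design G i k j * e i\<bar> \<le> c"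
  shows "(\<Sum>i\<in>{1..nobs G}. e i * lin_map G {1..ngrp G} h i)
     \<le> c * (\<Sum>k\<in>{1..ngrp G}. sqrt (real (gdim G k)) * block_norm G k h)"
proof -
  have "(\<Sum>i\<in>{1..nobs G}. e i * lin_map G {1..ngrp G} h i)
     = (\<Sum>i\<in>{1..nobs G}. \<Sum>k\<in>{1..ngrp G}. \<Sum>j\<in>{1..gdim G k}. design G i k j * e i * h k j)"
    by (simp add: lin_map_def sum_distrib_left mult_ac)
  also have "\<dots> = (\<Sum>k\<in>{1..ngrp G}. \<Sum>i\<in>{1..nobs G}. \<Sum>j\<in>{1..gdim G k}. design G i k j * e i * h k j)"
    by (rule sum.swap)
  also have "\<dots> = (\<Sum>k\<in>{1..ngrp G}. \<Sum>j\<in>{1..gdim G k}. \<Sum>i\<in>{1..nobs G}. design G i k j * e i * h k j)"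
    by (rule sum.cong[OF refl], rule sum.swap)
  also have "\<dots> \<le> (\<Sum>k\<in>{1..ngrp G}. c * (sqrt (real (gdim G k)) * block_norm G k h))"
  proof (rule sum_mono)
    fix k assume k: "k \<in> {1..ngrp G}"
    show "(\<Sum>j\<in>{1..gdim G k}. \<Sum>i\<in>{1..nobs G}. design G i k j * e i * h k j)
        \<le> c * (sqrt (real (gdim G k)) * block_norm G k h)"
    proof (cases "gdim G k = 0")
      case True then show ?thesis by simp
    next
      case False
      have c0: "0 \<le> c"
        using assms[of k 1] k False by (force simp: coeff_index_def)
      have "(\<Sum>j\<in>{1..gdim G k}. \<Sum>i\<in>{1..nobs G}. design G i k j * e i * h k j)
          = (\<Sum>j\<in>{1..gdim G k}. (\<Sum>i\<in>{1..nobs G}. design G i k j * e i) * h k j)"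
        by (simp add: sum_distrib_right)
      also have "\<dots> \<le> (\<Sum>j\<in>{1..gdim G k}. c * \<bar>h k j\<bar>)"
      proof (rule sum_mono)
        fix j assume "j \<in> {1..gdim G k}"
        then have "\<bar>\<Sum>i\<in>{1..nobs G}. design G i k j * e i\<bar> \<le> c"
          using k by (intro assms) (simp add: coeff_index_def)
        then have "\<bar>\<Sum>i\<in>{1..nobs G}. design G i k j * e i\<bar> * \<bar>h k j\<bar> \<le> c * \<bar>h k j\<bar>"
          by (rule mult_right_mono) simp
        then show "(\<Sum>i\<in>{1..nobs G}. design G i k j * e i) * h k j \<le> c * \<bar>h k j\<bar>"
          unfolding abs_mult[symmetric] by linarith
      qed
      also have "\<dots> = c * (\<Sum>j\<in>{1..gdim G k}. \<bar>1\<bar> * \<bar>h k j\<bar>)"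
        by (simp add: sum_distrib_left)
      also have "\<dots> \<le> c * (L2_set (\<lambda>_. 1) {1..gdim G k} * L2_set (h k) {1..gdim G k})"
        using c0 by (intro mult_left_mono L2_set_mult_ineq)
      finally show ?thesis
        by (simp add: block_norm_def L2_set_def)
    qed
  qed
  finally show ?thesis by (simp add: sum_distrib_left)
qed

text \<open>
  In the basic inequality the difference of the penalties is at most \<open>\<surd>d\<^sub>k \<parallel>h\<^sub>k\<parallel>\<close> on a large group.  On a
  small group it is at most \<open>\<surd>d\<^sub>k (2 \<parallel>\<beta>\<^sub>k\<parallel> - \<parallel>h\<^sub>k\<parallel>)\<close>, and the terms \<open>\<parallel>\<beta>\<^sub>k\<parallel>\<close> add up to at most
  \<open>\<eta>\<^sub>1\<close>.  Noise of relative size \<open>1/10\<close> changes the coefficient \<open>1\<close> to \<open>9/10\<close> and \<open>11/10\<close>.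
\<close>

lemma lasso_cone_inequality:
  fixes G :: grouped_model and y e :: "nat \<Rightarrow> real" and b :: "nat \<Rightarrow> nat \<Rightarrow> real"
  defines "h \<equiv> \<lambda>k j. b k j - coeff_true G k j"
  assumes lasso: "is_group_lasso G lam y b" and lam: "0 \<le> lam" and q: "nlarge G \<le> ngrp G"
    and y: "\<And>i. i \<in> {1..nobs G} \<Longrightarrow> y i = lin_map G {1..ngrp G} (coeff_true G) i + e i"
    and noise: "\<And>k j. (k, j) \<in> coeff_index G {1..ngrp G} \<Longrightarrow>
            \<bar>\<Sum>i\<in>{1..nobs G}. design G i k j * e i\<bar> \<le> lam / 10"
    and sparse: "generalized_sparsity G"
  shows "(obs_norm G (lin_map G {1..ngrp G} h))\<^sup>2
        + 9 / 10 * (lam * (\<Sum>k\<in>small_groups G. sqrt (real (gdim G k)) * block_norm G k h))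
     \<le> 11 / 10 * (lam * (\<Sum>k\<in>{1..nlarge G}. sqrt (real (gdim G k)) * block_norm G k h))
        + 2 * (lam * (sqrt (real (dim_a G)) * eta1 G))"
proof -
  let ?N = "{1..ngrp G}" and ?S = "{1..nlarge G}" and ?U = "small_groups G"
  let ?w = "\<lambda>k. sqrt (real (gdim G k))" and ?\<beta> = "coeff_true G"
  have N: "?N = ?S \<union> ?U" and disj: "?S \<inter> ?U = {}" and fin: "finite ?U"
    using q by (auto simp: small_groups_def)
  have split: "sum f ?N = sum f ?S + sum f ?U" for f :: "nat \<Rightarrow> real"
    unfolding N using disj fin by (intro sum.union_disjoint) auto
  have noise_sum: "(\<Sum>i\<in>{1..nobs G}. e i * lin_map G ?N h i) \<le> lam / 10 * (\<Sum>k\<in>?N. ?w k * block_norm G k h)"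
    using noise by (rule noise_inner_product_le)
  have large: "(\<Sum>k\<in>?S. ?w k * (block_norm G k ?\<beta> - block_norm G k b)) \<le> (\<Sum>k\<in>?S. ?w k * block_norm G k h)"
  proof (intro sum_mono mult_left_mono)
    fix k
    show "block_norm G k ?\<beta> - block_norm G k b \<le> block_norm G k h"
      using block_norm_le_add_diff[of G k ?\<beta> b] by (simp add: h_def)
  qed simp
  have "(\<Sum>k\<in>?U. ?w k * (block_norm G k ?\<beta> - block_norm G k b))
     \<le> (\<Sum>k\<in>?U. 2 * (sqrt (real (dim_a G)) * block_norm G k ?\<beta>) - ?w k * block_norm G k h)"
  proof (rule sum_mono)
    fix k assume "k \<in> ?U"
    then have "?w k \<le> sqrt (real (dim_a G))"
      using gdim_le_dim_a[of k G] by (simp add: small_groups_def)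
    then have "?w k * block_norm G k ?\<beta> \<le> sqrt (real (dim_a G)) * block_norm G k ?\<beta>"
      by (intro mult_right_mono block_norm_nonneg)
    moreover have "?w k * block_norm G k h \<le> ?w k * (block_norm G k b + block_norm G k ?\<beta>)"
      unfolding h_def by (intro mult_left_mono block_norm_diff_le_add) simp
    ultimately show "?w k * (block_norm G k ?\<beta> - block_norm G k b)
        \<le> 2 * (sqrt (real (dim_a G)) * block_norm G k ?\<beta>) - ?w k * block_norm G k h"
      by (simp add: algebra_simps)
  qed
  also have "\<dots> = 2 * (sqrt (real (dim_a G)) * (\<Sum>k\<in>?U. block_norm G k ?\<beta>)) - (\<Sum>k\<in>?U. ?w k * block_norm G k h)"
    by (simp add: sum_subtractf sum_distrib_left)
  also have "\<dots> \<le> 2 * (sqrt (real (dim_a G)) * eta1 G) - (\<Sum>k\<in>?U. ?w k * block_norm G k h)"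
    using sparse by (intro diff_right_mono mult_left_mono) (auto simp: generalized_sparsity_def)
  finally have "(\<Sum>k\<in>?N. ?w k * (block_norm G k ?\<beta> - block_norm G k b))
     \<le> (\<Sum>k\<in>?S. ?w k * block_norm G k h) + 2 * (sqrt (real (dim_a G)) * eta1 G)
        - (\<Sum>k\<in>?U. ?w k * block_norm G k h)"
    unfolding split using large by linarith
  from mult_left_mono[OF this lam]
  have "lam * (\<Sum>k\<in>?N. ?w k * (block_norm G k ?\<beta> - block_norm G k b))
     \<le> lam * (\<Sum>k\<in>?S. ?w k * block_norm G k h) + 2 * (lam * (sqrt (real (dim_a G)) * eta1 G))
        - lam * (\<Sum>k\<in>?U. ?w k * block_norm G k h)"
    by (simp add: algebra_simps)
  moreover have "lam / 10 * (\<Sum>k\<in>?N. ?w k * block_norm G k h)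
     = 1 / 10 * (lam * (\<Sum>k\<in>?S. ?w k * block_norm G k h)) + 1 / 10 * (lam * (\<Sum>k\<in>?U. ?w k * block_norm G k h))"
    unfolding split by (simp add: algebra_simps)
  ultimately show ?thesis
    using lasso_basic_inequality[OF lasso lam y] noise_sum unfolding h_def[symmetric]
    by linarith
qed

section \<open>Consequences of the sparse Riesz condition\<close>

text \<open>
  The sparse Riesz condition speaks about sets of exactly \<open>q\<^sup>*\<close> groups.  A smaller set is enlarged to
  one of that size, and the vector is extended by zero.
\<close>

lemma src_upper_bound:
  assumes src: "sparse_riesz G" and n: "1 \<le> nobs G"
    and T: "T \<subseteq> {1..ngrp G}" "card T \<le> rank_src G"
  shows "obs_norm G (lin_map G T v) \<le> sqrt (real (nobs G) * spec_hi G) * coeff_norm G T v"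
proof -
  have finT: "finite T" using T(1) finite_subset by blast
  obtain A where A: "T \<subseteq> A" "A \<subseteq> {1..ngrp G}" "card A = rank_src G"
    using exists_subset_between[of T "rank_src G" "{1..ngrp G}"] T src
    by (auto simp: sparse_riesz_def)
  have finA: "finite A" using A(2) finite_subset by blast
  define v' where "v' = (\<lambda>k j. if k \<in> T then v k j else 0)"
  have 1: "lin_map G A v' = lin_map G T v"
  proof
    fix i
    have "lin_map G A v' i = (\<Sum>k\<in>A. if k \<in> T then \<Sum>j\<in>{1..gdim G k}. design G i k j * v k j else 0)"
      unfolding lin_map_def v'_def by (intro sum.cong) auto
    then show "lin_map G A v' i = lin_map G T v i"
      using A(1) finA by (simp add: sum.If_cases lin_map_def Int_absorb1)
  qed
  have "(coeff_norm G A v')\<^sup>2 = (\<Sum>k\<in>A. if k \<in> T then (block_norm G k v)\<^sup>2 else 0)"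
    unfolding coeff_norm_power2[OF finA] block_norm_power2 v'_def by (intro sum.cong) auto
  also have "\<dots> = (coeff_norm G T v)\<^sup>2"
    using A(1) finA finT by (simp add: sum.If_cases coeff_norm_power2 Int_absorb1)
  finally have 2: "coeff_norm G A v' = coeff_norm G T v"
    by (simp add: coeff_norm_nonneg)
  have hi: "0 < spec_hi G" using src by (auto simp: sparse_riesz_def)
  have "(obs_norm G (lin_map G A v'))\<^sup>2 \<le> real (nobs G) * spec_hi G * (coeff_norm G A v')\<^sup>2"
  proof (cases "\<exists>(k, j)\<in>coeff_index G A. v' k j \<noteq> 0")
    case True
    then have "(obs_norm G (lin_map G A v'))\<^sup>2 / (real (nobs G) * (coeff_norm G A v')\<^sup>2) \<le> spec_hi G"
      using src A by (simp add: sparse_riesz_def)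
    moreover have "coeff_norm G A v' \<noteq> 0"
      using True finA by (auto simp: coeff_norm_def L2_set_eq_0_iff coeff_index_def)
    ultimately show ?thesis using n by (simp add: field_simps)
  next
    case False
    then have "lin_map G A v' i = 0" for i
      unfolding lin_map_def by (intro sum.neutral ballI) (auto simp: coeff_index_def)
    then show ?thesis using hi by (simp add: obs_norm_def L2_set_def)
  qed
  then have "(obs_norm G (lin_map G T v))\<^sup>2 \<le> real (nobs G) * spec_hi G * (coeff_norm G T v)\<^sup>2"
    by (simp add: 1 2)
  then have "sqrt ((obs_norm G (lin_map G T v))\<^sup>2) \<le> sqrt (real (nobs G) * spec_hi G * (coeff_norm G T v)\<^sup>2)"
    by (rule real_sqrt_le_mono)
  then show ?thesis by (simp add: real_sqrt_mult obs_norm_nonneg coeff_norm_nonneg)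
qed

lemma src_lower_bound:
  assumes src: "sparse_riesz G" and n: "1 \<le> nobs G"
    and A: "A \<subseteq> {1..ngrp G}" "card A = rank_src G"
  shows "sqrt (real (nobs G) * spec_lo G) * coeff_norm G A v \<le> obs_norm G (lin_map G A v)"
proof (cases "\<exists>(k, j)\<in>coeff_index G A. v k j \<noteq> 0")
  case True
  have finA: "finite A" using A(1) finite_subset by blast
  have "spec_lo G \<le> (obs_norm G (lin_map G A v))\<^sup>2 / (real (nobs G) * (coeff_norm G A v)\<^sup>2)"
    using src A True by (simp add: sparse_riesz_def)
  moreover have "coeff_norm G A v \<noteq> 0"
    using True finA by (auto simp: coeff_norm_def L2_set_eq_0_iff coeff_index_def)
  ultimately have "real (nobs G) * spec_lo G * (coeff_norm G A v)\<^sup>2 \<le> (obs_norm G (lin_map G A v))\<^sup>2"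
    using n by (simp add: field_simps)
  then have "sqrt (real (nobs G) * spec_lo G * (coeff_norm G A v)\<^sup>2) \<le> sqrt ((obs_norm G (lin_map G A v))\<^sup>2)"
    by (rule real_sqrt_le_mono)
  then show ?thesis by (simp add: real_sqrt_mult obs_norm_nonneg coeff_norm_nonneg)
next
  case False
  then have "coeff_norm G A v = 0"
    unfolding coeff_norm_def L2_set_def by (auto intro!: sum.neutral)
  then show ?thesis by (simp add: obs_norm_nonneg)
qed

lemma top_subset_exists:
  fixes f :: "'a \<Rightarrow> real"
  assumes "finite V" "s \<le> card V"
  shows "\<exists>T\<subseteq>V. card T = s \<and> (\<forall>k\<in>T. \<forall>l\<in>V - T. f l \<le> f k)"
  using assms(2)
proof (induction s)
  case 0
  show ?case by (rule exI[of _ "{}"]) simp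
next
  case (Suc s)
  then obtain T where T: "T \<subseteq> V" "card T = s" "\<forall>k\<in>T. \<forall>l\<in>V - T. f l \<le> f k" by auto
  have finT: "finite T" using T(1) assms(1) finite_subset by blast
  have "V - T \<noteq> {}" using Suc.prems T card_mono[OF finT, of V] by auto
  then have "Max (f ` (V - T)) \<in> f ` (V - T)" using assms(1) by (intro Max_in) auto
  then obtain m where m: "m \<in> V - T" "f m = Max (f ` (V - T))" by auto
  have "f l \<le> f m" if "l \<in> V - T" for l
    using that assms(1) m(2) by simp
  then show ?case using T m(1) finT by (intro exI[of _ "insert m T"]) auto
qed

lemma obs_norm_add_le: "obs_norm G (\<lambda>i. u i + v i) \<le> obs_norm G u + obs_norm G v"
  unfolding obs_norm_def by (rule L2_set_triangle_ineq)

lemma coeff_norm_le_of_blocks_le: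
  assumes "finite T" "card T \<le> s" "0 \<le> \<mu>" "\<And>k. k \<in> T \<Longrightarrow> block_norm G k v \<le> \<mu>"
  shows "coeff_norm G T v \<le> sqrt (real s) * \<mu>"
proof -
  have "(coeff_norm G T v)\<^sup>2 \<le> (\<Sum>k\<in>T. \<mu>\<^sup>2)"
    unfolding coeff_norm_power2[OF assms(1)]
    by (intro sum_mono power_mono assms(4) block_norm_nonneg)
  also have "\<dots> \<le> real s * \<mu>\<^sup>2" using assms(2) by (simp add: mult_right_mono)
  also have "\<dots> = (sqrt (real s) * \<mu>)\<^sup>2" by (simp add: power_mult_distrib)
  finally show ?thesis
    by (rule power2_le_imp_le) (use assms(3) in simp)
qed

text \<open>
  The image of a vector with arbitrarily many active groups is controlled by cutting its support
  into chunks of \<open>s\<close> groups in decreasing order of their block norms.  Each chunk obeys the upper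
  Riesz bound, and every block norm in a chunk is at most the average over the previous chunk, so
  the \<open>\<ell>\<^sub>2\<close>-norms of the chunks sum up to an \<open>\<ell>\<^sub>1\<close>-norm divided by \<open>\<surd>s\<close>; only the first chunk
  needs the a priori bound \<open>\<mu>\<close>.
\<close>

lemma obs_norm_le_peeling:
  assumes src: "sparse_riesz G" and n: "1 \<le> nobs G" and s: "1 \<le> s" "s \<le> rank_src G"
    and V: "V \<subseteq> {1..ngrp G}" and \<mu>: "0 \<le> \<mu>" "\<And>k. k \<in> V \<Longrightarrow> block_norm G k v \<le> \<mu>"
  shows "obs_norm G (lin_map G V v)
    \<le> sqrt (real (nobs G) * spec_hi G) * (sqrt (real s) * \<mu> + (\<Sum>k\<in>V. block_norm G k v) / sqrt (real s))"
  using V \<mu>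
proof (induction "card V" arbitrary: V \<mu> rule: less_induct)
  case less
  let ?c = "sqrt (real (nobs G) * spec_hi G)" and ?f = "\<lambda>k. block_norm G k v"
  have c0: "0 \<le> ?c" using src by (auto simp: sparse_riesz_def)
  have finV: "finite V" using less.prems(1) finite_subset by blast
  have head: "obs_norm G (lin_map G T v) \<le> ?c * (sqrt (real s) * \<mu>)" if "T \<subseteq> V" "card T \<le> s" for T
  proof -
    have "obs_norm G (lin_map G T v) \<le> ?c * coeff_norm G T v"
      using that less.prems(1) s by (intro src_upper_bound[OF src n]) auto
    also have "\<dots> \<le> ?c * (sqrt (real s) * \<mu>)"
      using that finV less.prems c0 finite_subset
      by (intro mult_left_mono coeff_norm_le_of_blocks_le) auto
    finally show ?thesis .
  qed
  show ?case
  proof (cases "card V \<le> s")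
    case True
    have "?c * (sqrt (real s) * \<mu>) \<le> ?c * (sqrt (real s) * \<mu> + (\<Sum>k\<in>V. ?f k) / sqrt (real s))"
      using c0 by (intro mult_left_mono) (auto intro!: divide_nonneg_nonneg sum_nonneg block_norm_nonneg)
    then show ?thesis using head[of V] True by simp
  next
    case False
    then obtain T where T: "T \<subseteq> V" "card T = s" "\<forall>k\<in>T. \<forall>l\<in>V - T. ?f l \<le> ?f k"
      using top_subset_exists[OF finV, of s ?f] by auto
    have finT: "finite T" using T(1) finV finite_subset by blast
    have "T \<noteq> {}" using T(2) s by auto
    define \<mu>' where "\<mu>' = Min (?f ` T)"
    \<comment> \<open>\<open>\<mu>'\<close> bounds the block norms after the first chunk and is at most the average over that chunk.\<close>
    have "\<mu>' \<in> ?f ` T" unfolding \<mu>'_def using finT \<open>T \<noteq> {}\<close> by (intro Min_in) auto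
    then have \<mu>': "0 \<le> \<mu>'" "\<And>l. l \<in> V - T \<Longrightarrow> ?f l \<le> \<mu>'"
      using T(3) block_norm_nonneg by auto
    have "real s * \<mu>' \<le> (\<Sum>k\<in>T. ?f k)"
      using sum_bounded_below[of T \<mu>' ?f] T(2) finT by (simp add: \<mu>'_def)
    then have \<mu>'_le: "sqrt (real s) * \<mu>' \<le> (\<Sum>k\<in>T. ?f k) / sqrt (real s)"
      using s by (simp add: field_simps)
    have "card (V - T) < card V"
      using T finV s finT by (simp add: card_Diff_subset) (use False in auto)
    then have IH: "obs_norm G (lin_map G (V - T) v)
        \<le> ?c * (sqrt (real s) * \<mu>' + (\<Sum>k\<in>V - T. ?f k) / sqrt (real s))"
      using less.hyps[of "V - T" \<mu>'] less.prems(1) \<mu>' by blast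
    have "lin_map G V v = (\<lambda>i. lin_map G T v i + lin_map G (V - T) v i)"
      using lin_map_Un[of T "V - T" G v] T(1) finT finV by (auto simp: Un_absorb1)
    then have "obs_norm G (lin_map G V v) \<le> obs_norm G (lin_map G T v) + obs_norm G (lin_map G (V - T) v)"
      by (simp add: obs_norm_add_le)
    also have "\<dots> \<le> ?c * (sqrt (real s) * \<mu>)
        + ?c * ((\<Sum>k\<in>T. ?f k) / sqrt (real s) + (\<Sum>k\<in>V - T. ?f k) / sqrt (real s))"
    proof (rule add_mono)
      show "obs_norm G (lin_map G T v) \<le> ?c * (sqrt (real s) * \<mu>)" using T by (intro head) auto
      show "obs_norm G (lin_map G (V - T) v)
         \<le> ?c * ((\<Sum>k\<in>T. ?f k) / sqrt (real s) + (\<Sum>k\<in>V - T. ?f k) / sqrt (real s))"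
        using IH mult_left_mono[OF add_right_mono[OF \<mu>'_le] c0] by (rule order_trans)
    qed
    also have "\<dots> = ?c * (sqrt (real s) * \<mu> + (\<Sum>k\<in>V. ?f k) / sqrt (real s))"
      using sum.subset_diff[OF T(1) finV, of ?f] by (simp add: algebra_simps add_divide_distrib)
    finally show ?thesis .
  qed
qed

text \<open>
  \<open>A\<close> consists of \<open>S\<close> and the \<open>s\<close> groups outside \<open>S\<close> that carry the largest blocks of \<open>v\<close>, so that the lower
  Riesz bound applies to \<open>A\<close>.  The remaining groups \<open>V\<close> are peeled off: their image is at most
  \<open>\<surd>(n c\<^sup>*) F / \<surd>s\<close>.  Let \<open>f\<^sub>T\<close> and \<open>f\<^sub>V\<close> be the sums of the block norms
  over \<open>A - S\<close> and over \<open>V\<close>, so that \<open>f\<^sub>T + f\<^sub>V = F\<close>.  Each block norm on \<open>V\<close> is at most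
  \<open>f\<^sub>T / s\<close>, hence \<open>\<parallel>v\<^sub>V\<parallel>\<^sup>2 \<le> f\<^sub>T f\<^sub>V / s \<le> F\<^sup>2 / (4 s)\<close>.
\<close>

lemma restricted_eigenvalue:
  fixes G :: grouped_model and S :: "nat set" and v :: "nat \<Rightarrow> nat \<Rightarrow> real"
  assumes src: "sparse_riesz G" and n: "1 \<le> nobs G"
    and S: "S \<subseteq> {1..ngrp G}" "card S < rank_src G"
  defines "s \<equiv> rank_src G - card S" and "F \<equiv> (\<Sum>k\<in>{1..ngrp G} - S. block_norm G k v)"
  obtains A where "S \<subseteq> A" "A \<subseteq> {1..ngrp G}"
    "sqrt (real (nobs G) * spec_lo G) * coeff_norm G A v
        \<le> obs_norm G (lin_map G {1..ngrp G} v) + sqrt (real (nobs G) * spec_hi G) * (F / sqrt (real s))"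
    "(coeff_norm G {1..ngrp G} v)\<^sup>2 \<le> (coeff_norm G A v)\<^sup>2 + (F / (2 * sqrt (real s)))\<^sup>2"
proof -
  let ?N = "{1..ngrp G}" and ?U = "{1..ngrp G} - S" and ?f = "\<lambda>k. block_norm G k v"
  let ?c = "sqrt (real (nobs G) * spec_hi G)"
  have s: "1 \<le> s" "s \<le> rank_src G" using S by (auto simp: s_def)
  have finS: "finite S" using S(1) finite_subset by blast
  have "card ?U = ngrp G - card S" using S(1) finS by (simp add: card_Diff_subset)
  then have "s \<le> card ?U" using src by (auto simp: s_def sparse_riesz_def)
  then obtain T where T: "T \<subseteq> ?U" "card T = s" "\<forall>k\<in>T. \<forall>l\<in>?U - T. ?f l \<le> ?f k"
    using top_subset_exists[of ?U s ?f] by auto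
  have finT: "finite T" using T(1) by (meson finite_Diff finite_atLeastAtMost finite_subset)
  have "T \<noteq> {}" using T(2) s by auto
  define V where "V = ?U - T"
  define A where "A = S \<union> T"
  define \<mu> where "\<mu> = Min (?f ` T)"
  have "\<mu> \<in> ?f ` T" unfolding \<mu>_def using finT \<open>T \<noteq> {}\<close> by (intro Min_in) auto
  then have \<mu>: "0 \<le> \<mu>" "\<And>l. l \<in> V \<Longrightarrow> ?f l \<le> \<mu>"
    using T(3) block_norm_nonneg by (auto simp: V_def)
  have s\<mu>: "real s * \<mu> \<le> (\<Sum>k\<in>T. ?f k)"
    using sum_bounded_below[of T \<mu> ?f] T(2) finT by (simp add: \<mu>_def)
  then have sqrt_s\<mu>: "sqrt (real s) * \<mu> \<le> (\<Sum>k\<in>T. ?f k) / sqrt (real s)"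
    using s by (simp add: field_simps)
  have F: "F = (\<Sum>k\<in>T. ?f k) + (\<Sum>k\<in>V. ?f k)"
    unfolding F_def V_def using sum.subset_diff[OF T(1), of ?f] by simp
  have A: "S \<subseteq> A" "A \<subseteq> ?N" using S(1) T(1) by (auto simp: A_def)
  have finA: "finite A" using finS finT by (simp add: A_def)
  have "card A = card S + s" unfolding A_def using finS finT T by (subst card_Un_disjoint) auto
  then have cardA: "card A = rank_src G" using S(2) by (simp add: s_def)
  have NAV: "?N = A \<union> V" "A \<inter> V = {}" "finite V" using S(1) T(1) by (auto simp: A_def V_def)

  have c0: "0 \<le> ?c" using src by (auto simp: sparse_riesz_def)
  have "obs_norm G (lin_map G V v) \<le> ?c * (sqrt (real s) * \<mu> + (\<Sum>k\<in>V. ?f k) / sqrt (real s))"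
    using NAV by (intro obs_norm_le_peeling[OF src n s] \<mu>) auto
  also have "\<dots> \<le> ?c * ((\<Sum>k\<in>T. ?f k) / sqrt (real s) + (\<Sum>k\<in>V. ?f k) / sqrt (real s))"
    using c0 sqrt_s\<mu> by (intro mult_left_mono add_right_mono)
  finally have tail: "obs_norm G (lin_map G V v) \<le> ?c * (F / sqrt (real s))"
    by (simp add: F add_divide_distrib)
  have "lin_map G A v = (\<lambda>i. lin_map G ?N v i + (\<Sum>k\<in>V. \<Sum>j\<in>{1..gdim G k}. design G i k j * (- v k j)))"
    unfolding NAV(1) using lin_map_Un[OF finA NAV(3) NAV(2), of G v]
    by (simp add: fun_eq_iff lin_map_def sum_negf)
  then have "obs_norm G (lin_map G A v) \<le> obs_norm G (lin_map G ?N v)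
       + obs_norm G (\<lambda>i. \<Sum>k\<in>V. \<Sum>j\<in>{1..gdim G k}. design G i k j * (- v k j))"
    by (simp only: obs_norm_add_le)
  also have "obs_norm G (\<lambda>i. \<Sum>k\<in>V. \<Sum>j\<in>{1..gdim G k}. design G i k j * (- v k j)) = obs_norm G (lin_map G V v)"
    by (simp add: obs_norm_def lin_map_def L2_set_def sum_negf)
  finally have "obs_norm G (lin_map G A v) \<le> obs_norm G (lin_map G ?N v) + ?c * (F / sqrt (real s))"
    using tail by simp
  with src_lower_bound[OF src n A(2) cardA, of v]
  have bound1: "sqrt (real (nobs G) * spec_lo G) * coeff_norm G A v
        \<le> obs_norm G (lin_map G ?N v) + ?c * (F / sqrt (real s))"
    by simp

  have "(coeff_norm G V v)\<^sup>2 = (\<Sum>k\<in>V. ?f k * ?f k)"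
    by (subst coeff_norm_power2[OF NAV(3)]) (simp add: power2_eq_square)
  also have "\<dots> \<le> (\<Sum>k\<in>V. \<mu> * ?f k)"
    by (intro sum_mono mult_right_mono \<mu> block_norm_nonneg)
  also have "\<dots> = \<mu> * (\<Sum>k\<in>V. ?f k)" by (simp add: sum_distrib_left)
  also have "\<dots> \<le> (F / (2 * sqrt (real s)))\<^sup>2"
  proof -
    have "real s * \<mu> * (\<Sum>k\<in>V. ?f k) \<le> (\<Sum>k\<in>T. ?f k) * (\<Sum>k\<in>V. ?f k)"
      using s\<mu> by (intro mult_right_mono sum_nonneg block_norm_nonneg)
    also have "\<dots> \<le> F\<^sup>2 / 4"
      using zero_le_power2[of "(\<Sum>k\<in>T. ?f k) - (\<Sum>k\<in>V. ?f k)"]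
      unfolding F by (simp add: power2_eq_square algebra_simps)
    finally show ?thesis using s by (simp add: power_divide power_mult_distrib field_simps)
  qed
  finally have V_le: "(coeff_norm G V v)\<^sup>2 \<le> (F / (2 * sqrt (real s)))\<^sup>2" .
  have "(coeff_norm G ?N v)\<^sup>2 = (coeff_norm G A v)\<^sup>2 + (coeff_norm G V v)\<^sup>2"
    using finA NAV by (simp add: coeff_norm_power2 sum.union_disjoint)
  with V_le have "(coeff_norm G ?N v)\<^sup>2 \<le> (coeff_norm G A v)\<^sup>2 + (F / (2 * sqrt (real s)))\<^sup>2" by simp
  then show thesis using that A bound1 by blast
qed

lemma sum_block_norm_le_coeff_norm:
  assumes "finite A" "S \<subseteq> A"
  shows "(\<Sum>k\<in>S. block_norm G k v) \<le> sqrt (real (card S)) * coeff_norm G A v"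
proof -
  have "(\<Sum>k\<in>S. block_norm G k v) = (\<Sum>k\<in>S. \<bar>1\<bar> * \<bar>block_norm G k v\<bar>)"
    by (simp add: block_norm_nonneg)
  also have "\<dots> \<le> L2_set (\<lambda>_. 1) S * L2_set (\<lambda>k. block_norm G k v) S"
    by (rule L2_set_mult_ineq)
  also have "\<dots> = sqrt (real (card S)) * sqrt (\<Sum>k\<in>S. (block_norm G k v)\<^sup>2)"
    by (simp add: L2_set_def)
  also have "\<dots> \<le> sqrt (real (card S)) * sqrt (\<Sum>k\<in>A. (block_norm G k v)\<^sup>2)"
    using assms by (intro mult_left_mono real_sqrt_le_mono sum_mono2) auto
  also have "\<dots> = sqrt (real (card S)) * coeff_norm G A v"
    unfolding coeff_norm_power2[OF assms(1), symmetric] by (simp add: coeff_norm_nonneg)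
  finally show ?thesis .
qed

section \<open>Deterministic error bounds\<close>

text \<open>
  The inequality to which everything reduces once lengths are measured in a suitable unit: \<open>x\<close> is the
  prediction error and \<open>t\<close> the size of the error on the small groups.  With all quantities in units of \<open>S\<close> it implies
  \<open>x\<^sup>2 + (1.8 - 1.1 \<kappa>) t \<le> 1.1 \<kappa> x + 2 (1 - \<kappa>\<^sup>2)\<close> with \<open>\<kappa> = K / S \<in> [0, 1]\<close>.  Completing the square in
  \<open>x\<close> bounds \<open>x + t\<close> and \<open>t\<close> by rational functions of \<open>\<kappa>\<close>.  The constants are chosen so that
  \<open>1.85\<^sup>2 + (1.5 / 2)\<^sup>2 \<le> 4\<close>, which is what the estimation error needs; bounding that error by
  \<open>x + t + t / 2\<close> instead could exceed \<open>2 S\<close>.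
\<close>

lemma cone_arithmetic:
  fixes x t K r S \<tau> :: real
  assumes pos: "0 \<le> x" "0 \<le> t" "0 \<le> K" "0 < S" and S: "S\<^sup>2 = r\<^sup>2 + K\<^sup>2" and \<tau>: "2 * S \<le> \<tau>"
    and cone: "x\<^sup>2 + 9 / 10 * \<tau> * t \<le> 11 / 10 * K * (x + t) + 2 * r\<^sup>2"
  shows "x + t \<le> 185 / 100 * S" "t \<le> 3 / 2 * S"
proof -
  define \<kappa> where "\<kappa> = K / S"
  define x' where "x' = x / S"
  define t' where "t' = t / S"
  have K: "K = \<kappa> * S" and x: "x = x' * S" and t: "t = t' * S"
    using pos by (auto simp: \<kappa>_def x'_def t'_def)
  have "K\<^sup>2 \<le> S\<^sup>2" using S by simp
  then have "K \<le> S" by (rule power2_le_imp_le) (use pos in simp)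
  then have "\<kappa> \<le> 1" using pos by (simp add: \<kappa>_def)
  have "0 \<le> \<kappa>" using pos by (simp add: \<kappa>_def)
  have "2 * S * t \<le> \<tau> * t" using \<tau> pos by (intro mult_right_mono)
  with cone S have raw: "x\<^sup>2 + 18 / 10 * (S * t) \<le> 11 / 10 * (K * (x + t)) + 2 * (S\<^sup>2 - K\<^sup>2)"
    by simp
  define E where "E = 11 / 10 * (\<kappa> * x') + 11 / 10 * (\<kappa> * t') + 2 - 2 * \<kappa>\<^sup>2 - x'\<^sup>2 - 18 / 10 * t'"
  have "S\<^sup>2 * E = 11 / 10 * (K * (x + t)) + 2 * (S\<^sup>2 - K\<^sup>2) - x\<^sup>2 - 18 / 10 * (S * t)"
    unfolding K x t E_def by (simp add: power2_eq_square algebra_simps)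
  with raw have "0 \<le> S\<^sup>2 * E" by simp
  then have E: "0 \<le> E" using pos by (simp add: zero_le_mult_iff)
  have g: "0 < 18 / 10 - 11 / 10 * \<kappa>" using \<open>\<kappa> \<le> 1\<close> by simp
  \<comment> \<open>The bound on \<open>x + t\<close>; for a given sum, the worst \<open>x\<close> is \<open>9/10\<close>.\<close>
  have "(18 / 10 - 11 / 10 * \<kappa>) * (x' + t')
      = 18 / 10 * x' + 18 / 10 * t' - 11 / 10 * (\<kappa> * x') - 11 / 10 * (\<kappa> * t')"
    by (simp add: field_simps)
  moreover have "(x' - 9 / 10)\<^sup>2 = x'\<^sup>2 - 18 / 10 * x' + 81 / 100"
    by (simp add: power2_eq_square field_simps)
  ultimately have "(18 / 10 - 11 / 10 * \<kappa>) * (x' + t') \<le> 281 / 100 - 2 * \<kappa>\<^sup>2"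
    using E zero_le_power2[of "x' - 9 / 10"] unfolding E_def by linarith
  also have "\<dots> \<le> (18 / 10 - 11 / 10 * \<kappa>) * (185 / 100)"
  proof -
    \<comment> \<open>\<open>2 \<kappa>\<^sup>2 - 2.035 \<kappa> + 0.52\<close> is positive: its minimum is at \<open>407/800\<close>.\<close>
    have "(\<kappa> - 407 / 800)\<^sup>2 = \<kappa>\<^sup>2 - 407 / 400 * \<kappa> + 165649 / 640000"
      by (simp add: power2_eq_square field_simps)
    moreover have "(18 / 10 - 11 / 10 * \<kappa>) * (185 / 100) = 333 / 100 - 407 / 200 * \<kappa>"
      by (simp add: field_simps)
    ultimately show ?thesis using zero_le_power2[of "\<kappa> - 407 / 800"] \<open>\<kappa> \<le> 1\<close> \<open>0 \<le> \<kappa>\<close> by linarith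
  qed
  finally have "x' + t' \<le> 185 / 100"
    using g by (rule mult_left_le_imp_le)
  then have "(x' + t') * S \<le> 185 / 100 * S" using pos by (intro mult_right_mono) auto
  then show "x + t \<le> 185 / 100 * S" by (simp add: x t distrib_right)
  \<comment> \<open>The bound on \<open>t\<close>; here the worst \<open>x\<close> is \<open>11 \<kappa> / 20\<close>.\<close>
  have "(18 / 10 - 11 / 10 * \<kappa>) * t' = 18 / 10 * t' - 11 / 10 * (\<kappa> * t')"
    by (simp add: field_simps)
  moreover have "(x' - 11 / 20 * \<kappa>)\<^sup>2 = x'\<^sup>2 - 11 / 10 * (\<kappa> * x') + 121 / 400 * \<kappa>\<^sup>2"
    by (simp add: power2_eq_square field_simps)
  ultimately have "(18 / 10 - 11 / 10 * \<kappa>) * t' \<le> 2 - 679 / 400 * \<kappa>\<^sup>2"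
    using E zero_le_power2[of "x' - 11 / 20 * \<kappa>"] unfolding E_def by linarith
  also have "\<dots> \<le> (18 / 10 - 11 / 10 * \<kappa>) * (3 / 2)"
  proof -
    have "(\<kappa> - 1 / 2)\<^sup>2 = \<kappa>\<^sup>2 - \<kappa> + 1 / 4"
      by (simp add: power2_eq_square field_simps)
    moreover have "(18 / 10 - 11 / 10 * \<kappa>) * (3 / 2) = 27 / 10 - 33 / 20 * \<kappa>"
      by (simp add: field_simps)
    ultimately show ?thesis using zero_le_power2[of "\<kappa> - 1 / 2"] \<open>\<kappa> \<le> 1\<close> \<open>0 \<le> \<kappa>\<close> by linarith
  qed
  finally have "t' \<le> 3 / 2"
    using g by (rule mult_left_le_imp_le)
  then have "t' * S \<le> 3 / 2 * S" using pos by (intro mult_right_mono) auto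
  then show "t \<le> 3 / 2 * S" by (simp add: t)
qed

text \<open>
  Write \<open>D = d c\<^sup>* / c\<^sub>*\<close>, \<open>s = q\<^sup>* - q\<close> and \<open>B = \<lambda> \<surd>(d\<^sub>b q / (n c\<^sup>*))\<close>.  Let \<open>x\<close> be the prediction
  error in units of \<open>B\<close>, and let \<open>t\<close> be \<open>\<surd>(n c\<^sup>* / s)\<close> times the sum of the block norms of \<open>h\<close> on the
  small groups, again in units of \<open>B\<close>.  In units of \<open>B\<^sup>2\<close>, the penalty of \<open>h\<close> on the large groups is
  at most \<open>\<surd>D (x + t)\<close> by the restricted eigenvalue bound, its penalty on the small groups is at
  least \<open>\<surd>(s / q) t\<close>, and the contribution of \<open>\<eta>\<^sub>1\<close> is \<open>2 r\<^sub>1\<^sup>2\<close>.  The rank condition gives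
  \<open>s \<ge> 4 (r\<^sub>1\<^sup>2 + D) q\<close>, so the second penalty outweighs the term with \<open>t\<close> in the first one, and
  \<open>\<parallel>X h\<parallel>\<close> and \<open>\<surd>(n c\<^sub>*) \<parallel>h\<parallel>\<close> are both at most \<open>2 \<surd>(r\<^sub>1\<^sup>2 + D) B\<close>.
\<close>

lemma group_lasso_error_bounds:
  fixes G :: grouped_model and lam :: real and y e :: "nat \<Rightarrow> real" and b :: "nat \<Rightarrow> nat \<Rightarrow> real"
  defines "h \<equiv> \<lambda>k j. b k j - coeff_true G k j"
    and "R \<equiv> 2 * sqrt ((r1 G lam)\<^sup>2 + dim_ratio G * spec_ratio G)
             * (lam * sqrt (real (dim_b G) * real (nlarge G) / (real (nobs G) * spec_hi G)))"
  assumes src: "sparse_riesz G"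
    and q: "1 \<le> nlarge G" "nlarge G \<le> ngrp G" and n: "1 \<le> nobs G"
    and gdim_pos: "\<And>k. k \<in> {1..ngrp G} \<Longrightarrow> 1 \<le> gdim G k"
    and sparse: "generalized_sparsity G"
    and lam: "0 < lam" and rank: "M1 G lam * real (nlarge G) + 1 \<le> real (rank_src G)"
    and lasso: "is_group_lasso G lam y b"
    and y: "\<And>i. i \<in> {1..nobs G} \<Longrightarrow> y i = lin_map G {1..ngrp G} (coeff_true G) i + e i"
    and noise: "\<And>k j. (k, j) \<in> coeff_index G {1..ngrp G} \<Longrightarrow>
            \<bar>\<Sum>i\<in>{1..nobs G}. design G i k j * e i\<bar> \<le> lam / 10"
  shows "sqrt (real (nobs G) * spec_lo G) * coeff_norm G {1..ngrp G} h \<le> R"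
    and "obs_norm G (lin_map G {1..ngrp G} h) \<le> R"
proof -
  let ?N = "{1..ngrp G}" and ?S = "{1..nlarge G}" and ?U = "small_groups G"
  define n' where "n' = real (nobs G)"
  define q' where "q' = real (nlarge G)"
  define clo where "clo = spec_lo G"
  define chi where "chi = spec_hi G"
  define da where "da = real (dim_a G)"
  define db where "db = real (dim_b G)"
  define D where "D = dim_ratio G * spec_ratio G"
  define r where "r = r1 G lam"
  define s where "s = rank_src G - nlarge G"
  define s' where "s' = real s"
  define X where "X = obs_norm G (lin_map G ?N h)"
  define T where "T = (\<Sum>k\<in>?U. sqrt (real (gdim G k)) * block_norm G k h)"
  define W where "W = (\<Sum>k\<in>?S. sqrt (real (gdim G k)) * block_norm G k h)"
  define F where "F = (\<Sum>k\<in>?N - ?S. block_norm G k h)"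
  define B where "B = lam * sqrt (db * q' / (n' * chi))"
  define S where "S = sqrt (r\<^sup>2 + D)"
  have p: "1 \<le> ngrp G" using q by simp
  have ratios: "1 < spec_ratio G" "1 \<le> dim_ratio G"
    using spec_ratio_gt_1[OF src] dim_ratio_ge_1[OF p gdim_pos] by auto
  have D_ge: "1 \<le> D" unfolding D_def using mult_mono[of 1 "dim_ratio G" 1 "spec_ratio G"] ratios by simp
  have db1: "1 \<le> dim_b G" using dim_b_pos[of G, OF p gdim_pos] .
  have da1: "1 \<le> dim_a G" using db1 dim_b_le_dim_a[OF p] by simp
  have pos: "0 < n'" "0 < q'" "0 < clo" "0 < chi" "0 < da" "0 < db"
    using n q src db1 da1
    by (auto simp: n'_def q'_def clo_def chi_def da_def db_def sparse_riesz_def)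
  have clo_chi: "clo \<le> chi" using src by (simp add: clo_def chi_def sparse_riesz_def)
  have D_eq: "D = (da * chi) / (db * clo)"
    by (simp add: D_def dim_ratio_def spec_ratio_def da_def db_def chi_def clo_def)
  have eta: "0 \<le> eta1 G" using sparse by (simp add: generalized_sparsity_def)
  have r_sq: "r\<^sup>2 = n' * chi * sqrt da * eta1 G / (lam * db * q')"
    unfolding r_def r1_def n'_def[symmetric] chi_def[symmetric] da_def[symmetric] db_def[symmetric] q'_def[symmetric]
    using pos eta lam by (intro real_sqrt_pow2 divide_nonneg_nonneg mult_nonneg_nonneg) auto
  have "M1 G lam \<ge> 2 + 4 * r\<^sup>2 + 4 * D"
    using r2_nonneg[OF src, of lam] D_ge by (simp add: M1_def r_def D_def)
  then have "(2 + 4 * r\<^sup>2 + 4 * D) * q' \<le> M1 G lam * q'" using pos by (intro mult_right_mono) auto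
  then have rank': "(2 + 4 * r\<^sup>2 + 4 * D) * q' + 1 \<le> real (rank_src G)"
    using rank by (simp add: q'_def)
  have "q' \<le> (2 + 4 * r\<^sup>2 + 4 * D) * q'"
    using pos D_ge zero_le_power2[of r] by (simp add: mult_le_cancel_right1)
  then have "real (nlarge G) < real (rank_src G)" using rank' unfolding q'_def by linarith
  then have cardS: "card ?S < rank_src G" by simp
  have s'_eq: "s' = real (rank_src G) - q'" using cardS by (simp add: s'_def s_def q'_def)
  have s'_ge: "4 * (r\<^sup>2 + D) * q' \<le> s'"
    using rank' pos unfolding s'_eq by (simp add: algebra_simps)
  have s'_pos: "0 < s'" using cardS by (simp add: s'_def s_def)

  have cone0: "X\<^sup>2 + 9 / 10 * (lam * T) \<le> 11 / 10 * (lam * W) + 2 * (lam * (sqrt da * eta1 G))"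
    unfolding X_def T_def W_def da_def h_def
    using lam by (intro lasso_cone_inequality[OF lasso _ q(2) y noise sparse]) auto
  obtain A where A: "?S \<subseteq> A" "A \<subseteq> ?N"
    and A1: "sqrt (n' * clo) * coeff_norm G A h \<le> X + sqrt (n' * chi) * (F / sqrt s')"
    and A2: "(coeff_norm G ?N h)\<^sup>2 \<le> (coeff_norm G A h)\<^sup>2 + (F / (2 * sqrt s'))\<^sup>2"
    using restricted_eigenvalue[OF src n _ cardS, of h] q(2)
    unfolding n'_def clo_def chi_def X_def F_def s'_def s_def by auto
  have finA: "finite A" using A(2) finite_subset by blast
  have US: "?N - ?S = ?U" by (auto simp: small_groups_def)
  have FT: "sqrt db * F \<le> T"
    unfolding F_def T_def US sum_distrib_left db_def
    using dim_b_le_gdim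
    by (intro sum_mono mult_right_mono block_norm_nonneg) (auto simp: small_groups_def)
  have F0: "0 \<le> F" unfolding F_def by (intro sum_nonneg block_norm_nonneg)
  have T0: "0 \<le> T" unfolding T_def by (intro sum_nonneg mult_nonneg_nonneg block_norm_nonneg) auto
  have "W \<le> sqrt da * (\<Sum>k\<in>?S. block_norm G k h)"
    unfolding W_def sum_distrib_left da_def
    using gdim_le_dim_a q(2) by (intro sum_mono mult_right_mono block_norm_nonneg) auto
  also have "\<dots> \<le> sqrt da * (sqrt q' * coeff_norm G A h)"
    using sum_block_norm_le_coeff_norm[OF finA A(1), of G h] pos
    by (intro mult_left_mono) (auto simp: q'_def)
  finally have W_le: "W \<le> sqrt (da * q') * coeff_norm G A h"
    by (simp add: real_sqrt_mult)

  \<comment> \<open>In units of \<open>B\<close> the design enters only through \<open>D\<close>, \<open>r\<close> and \<open>s / q\<close>.\<close>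
  have B_pos: "0 < B" using pos lam by (simp add: B_def)
  define x where "x = X / B"
  define t where "t = sqrt (n' * chi) * (F / sqrt s') / B"
  define \<tau> where "\<tau> = sqrt (s' / q')"
  have x0: "0 \<le> x" and t0: "0 \<le> t"
    using B_pos F0 s'_pos pos by (auto simp: x_def t_def X_def obs_norm_nonneg)
  have X: "X = x * B" and tB: "sqrt (n' * chi) * (F / sqrt s') = t * B"
    using B_pos by (auto simp: x_def t_def)
  have lamB: "lam * sqrt (db * s') = sqrt (n' * chi) * (\<tau> * B)"
    unfolding \<tau>_def B_def using pos s'_pos
    by (simp add: real_sqrt_mult real_sqrt_divide field_simps)
  have "lam * T \<ge> lam * (sqrt db * F)" using FT lam by simp
  also have "lam * (sqrt db * F) = lam * sqrt (db * s') * (F / sqrt s')"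
    using s'_pos by (simp add: real_sqrt_mult)
  also have "\<dots> = \<tau> * t * B\<^sup>2"
    unfolding lamB using tB by (simp add: power2_eq_square mult_ac)
  finally have lamT: "\<tau> * t * B\<^sup>2 \<le> lam * T" .
  have lamA: "lam * sqrt (da * q') = sqrt D * B * sqrt (n' * clo)"
    unfolding D_eq B_def using pos
    by (simp add: real_sqrt_mult real_sqrt_divide field_simps)
  have "lam * W \<le> lam * (sqrt (da * q') * coeff_norm G A h)"
    using W_le lam by simp
  also have "\<dots> = sqrt D * B * (sqrt (n' * clo) * coeff_norm G A h)"
    using lamA by (simp add: mult.assoc[symmetric])
  also have "\<dots> \<le> sqrt D * B * (x * B + t * B)"
    using A1 B_pos D_ge unfolding X tB by (intro mult_left_mono) auto
  finally have lamW: "lam * W \<le> sqrt D * (x + t) * B\<^sup>2"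
    by (simp add: power2_eq_square algebra_simps)
  have lam_eta: "lam * (sqrt da * eta1 G) = r\<^sup>2 * B\<^sup>2"
  proof -
    have "B\<^sup>2 = lam\<^sup>2 * (db * q' / (n' * chi))"
      unfolding B_def using pos by (simp add: power_mult_distrib)
    then show ?thesis unfolding r_sq using pos lam by (simp add: power2_eq_square field_simps)
  qed
  have "(x\<^sup>2 + 9 / 10 * \<tau> * t) * B\<^sup>2 \<le> (11 / 10 * sqrt D * (x + t) + 2 * r\<^sup>2) * B\<^sup>2"
  proof -
    have "(x\<^sup>2 + 9 / 10 * \<tau> * t) * B\<^sup>2 = x\<^sup>2 * B\<^sup>2 + 9 / 10 * (\<tau> * t * B\<^sup>2)"
      "(11 / 10 * sqrt D * (x + t) + 2 * r\<^sup>2) * B\<^sup>2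
        = 11 / 10 * (sqrt D * (x + t) * B\<^sup>2) + 2 * (r\<^sup>2 * B\<^sup>2)"
      by (simp_all add: distrib_right)
    then show ?thesis
      using cone0 lamT lamW unfolding lam_eta X power_mult_distrib by linarith
  qed
  then have cone: "x\<^sup>2 + 9 / 10 * \<tau> * t \<le> 11 / 10 * sqrt D * (x + t) + 2 * r\<^sup>2"
    using B_pos by simp
  have S_sq: "S\<^sup>2 = r\<^sup>2 + (sqrt D)\<^sup>2" using D_ge by (simp add: S_def)
  have S_pos: "0 < S" unfolding S_def using D_ge by (auto intro: add_nonneg_pos)
  have "sqrt (4 * (r\<^sup>2 + D)) \<le> \<tau>"
    unfolding \<tau>_def using s'_ge pos by (intro real_sqrt_le_mono) (simp add: field_simps)
  then have \<tau>: "2 * S \<le> \<tau>" unfolding S_def real_sqrt_mult real_sqrt_four .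
  have D0: "0 \<le> sqrt D" using D_ge by simp
  note arith = cone_arithmetic[OF x0 t0 D0 S_pos S_sq \<tau> cone]
  have R: "R = 2 * S * B"
    by (simp add: R_def S_def B_def r_def D_def db_def q'_def n'_def chi_def)
  show "obs_norm G (lin_map G ?N h) \<le> R"
  proof -
    have "x \<le> 2 * S" using arith(1) t0 S_pos by linarith
    then have "x * B \<le> 2 * S * B" using B_pos by (intro mult_right_mono) auto
    then show ?thesis unfolding R using X by (simp add: X_def)
  qed
  show "sqrt (real (nobs G) * spec_lo G) * coeff_norm G ?N h \<le> R"
  proof -
    have "sqrt (n' * clo) * (F / (2 * sqrt s')) \<le> sqrt (n' * chi) * (F / (2 * sqrt s'))"
      using clo_chi pos F0 s'_pos by (intro mult_right_mono real_sqrt_le_mono) auto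
    also have "\<dots> = t / 2 * B" using tB by simp
    also have "\<dots> \<le> 3 / 4 * S * B"
      using arith(2) B_pos by (intro mult_right_mono) auto
    finally have rest: "sqrt (n' * clo) * (F / (2 * sqrt s')) \<le> 3 / 4 * S * B" .
    have "sqrt (n' * clo) * coeff_norm G A h \<le> (x + t) * B"
      using A1 unfolding X tB by (simp add: algebra_simps)
    also have "\<dots> \<le> 185 / 100 * S * B"
      using arith(1) B_pos by (intro mult_right_mono) auto
    finally have head: "sqrt (n' * clo) * coeff_norm G A h \<le> 185 / 100 * S * B" .
    have "(sqrt (n' * clo) * coeff_norm G ?N h)\<^sup>2
        \<le> (sqrt (n' * clo))\<^sup>2 * ((coeff_norm G A h)\<^sup>2 + (F / (2 * sqrt s'))\<^sup>2)"
      unfolding power_mult_distrib by (intro mult_left_mono A2) simp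
    also have "\<dots> = (sqrt (n' * clo) * coeff_norm G A h)\<^sup>2 + (sqrt (n' * clo) * (F / (2 * sqrt s')))\<^sup>2"
      by (simp only: power_mult_distrib distrib_left)
    also have "\<dots> \<le> (185 / 100 * S * B)\<^sup>2 + (3 / 4 * S * B)\<^sup>2"
      using head rest pos F0 s'_pos by (intro add_mono power_mono) (auto simp: coeff_norm_nonneg)
    also have "\<dots> = (34225 / 10000 + 9 / 16) * (S * B)\<^sup>2"
      by (simp add: power2_eq_square)
    also have "\<dots> \<le> 4 * (S * B)\<^sup>2" by (intro mult_right_mono) auto
    also have "\<dots> = R\<^sup>2" by (simp add: R power_mult_distrib)
    finally have "sqrt (n' * clo) * coeff_norm G ?N h \<le> R"
      by (rule power2_le_imp_le) (use S_pos B_pos in \<open>simp add: R\<close>)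
    then show ?thesis by (simp add: n'_def clo_def)
  qed
qed

section \<open>Gaussian noise\<close>

text \<open>
  Multiplying a centred normal density by \<open>exp (s x)\<close> yields, up to the constant \<open>exp (s\<^sup>2 \<sigma>\<^sup>2 / 2)\<close>, the
  normal density with mean \<open>s \<sigma>\<^sup>2\<close>, which has total mass one.
\<close>

lemma normal_mgf:
  assumes \<sigma>: "0 < \<sigma>" and Z: "distributed M lborel Z (normal_density 0 \<sigma>)"
  shows "(\<integral>\<^sup>+\<omega>. ennreal (exp (s * Z \<omega>)) \<partial>M) = ennreal (exp (s\<^sup>2 * \<sigma>\<^sup>2 / 2))"
proof -
  interpret shifted: prob_space "density lborel (normal_density (s * \<sigma>\<^sup>2) \<sigma>)"
    using \<sigma> by (rule prob_space_normal_density)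
  have total: "(\<integral>\<^sup>+x. ennreal (normal_density (s * \<sigma>\<^sup>2) \<sigma> x) \<partial>lborel) = 1"
    using shifted.emeasure_space_1 by (simp add: emeasure_density)
  have tilt: "normal_density 0 \<sigma> x * exp (s * x) = exp (s\<^sup>2 * \<sigma>\<^sup>2 / 2) * normal_density (s * \<sigma>\<^sup>2) \<sigma> x" for x
  proof -
    have "- x\<^sup>2 / (2 * \<sigma>\<^sup>2) + s * x = s\<^sup>2 * \<sigma>\<^sup>2 / 2 + - (x - s * \<sigma>\<^sup>2)\<^sup>2 / (2 * \<sigma>\<^sup>2)"
      using \<sigma> by (simp add: power2_eq_square field_simps)
    then have "exp (- x\<^sup>2 / (2 * \<sigma>\<^sup>2)) * exp (s * x)
        = exp (s\<^sup>2 * \<sigma>\<^sup>2 / 2) * exp (- (x - s * \<sigma>\<^sup>2)\<^sup>2 / (2 * \<sigma>\<^sup>2))"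
      by (simp only: exp_add[symmetric])
    then show ?thesis by (simp add: normal_density_def)
  qed
  have "(\<integral>\<^sup>+\<omega>. ennreal (exp (s * Z \<omega>)) \<partial>M)
      = (\<integral>\<^sup>+x. ennreal (normal_density 0 \<sigma> x) * ennreal (exp (s * x)) \<partial>lborel)"
    by (rule distributed_nn_integral[OF Z, symmetric]) measurable
  also have "\<dots> = (\<integral>\<^sup>+x. ennreal (exp (s\<^sup>2 * \<sigma>\<^sup>2 / 2)) * ennreal (normal_density (s * \<sigma>\<^sup>2) \<sigma> x) \<partial>lborel)"
    by (simp add: ennreal_mult[symmetric] tilt)
  also have "\<dots> = ennreal (exp (s\<^sup>2 * \<sigma>\<^sup>2 / 2))"
    by (simp add: nn_integral_cmult total)
  finally show ?thesis .
qed

context prob_space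
begin

text \<open>
  Chernoff bound with the exponent \<open>l = u / (\<sigma>\<^sup>2 v)\<close>, the minimiser of
  \<open>- l u + l\<^sup>2 \<sigma>\<^sup>2 v / 2\<close>.
\<close>

lemma gaussian_linear_form_upper_tail:
  fixes X :: "nat \<Rightarrow> 'a \<Rightarrow> real" and w :: "nat \<Rightarrow> real"
  assumes fin: "finite I" and indep: "indep_vars (\<lambda>_. borel) X I" and \<sigma>: "0 < \<sigma>"
    and normal: "\<And>i. i \<in> I \<Longrightarrow> distributed M lborel (X i) (normal_density 0 \<sigma>)"
    and v: "0 < v" "(\<Sum>i\<in>I. (w i)\<^sup>2) \<le> v" and u: "0 < u"
  shows "prob {\<omega> \<in> space M. u \<le> (\<Sum>i\<in>I. w i * X i \<omega>)} \<le> exp (- u\<^sup>2 / (2 * \<sigma>\<^sup>2 * v))"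
proof -
  define l where "l = u / (\<sigma>\<^sup>2 * v)"
  have l: "0 < l" using u v \<sigma> by (simp add: l_def)
  have [measurable]: "X i \<in> borel_measurable M" if "i \<in> I" for i
    using indep that by (auto simp: indep_vars_def2)
  have [measurable]: "(\<lambda>\<omega>. \<Sum>i\<in>I. w i * X i \<omega>) \<in> borel_measurable M"
    by (intro borel_measurable_sum borel_measurable_times) auto
  have "ennreal (prob {\<omega> \<in> space M. u \<le> (\<Sum>i\<in>I. w i * X i \<omega>)})
      = emeasure M {\<omega> \<in> space M. u \<le> (\<Sum>i\<in>I. w i * X i \<omega>)}"
    by (simp add: emeasure_eq_measure)
  also have "\<dots> \<le> ennreal (exp (- l * u)) * (\<integral>\<^sup>+\<omega>\<in>space M. exp (l * (\<Sum>i\<in>I. w i * X i \<omega>)) \<partial>M)"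
    by (intro Chernoff_ineq_nn_integral_ge l) auto
  also have "(\<integral>\<^sup>+\<omega>\<in>space M. exp (l * (\<Sum>i\<in>I. w i * X i \<omega>)) \<partial>M)
      = (\<integral>\<^sup>+\<omega>. (\<Prod>i\<in>I. ennreal (exp (l * w i * X i \<omega>))) \<partial>M)"
    by (intro nn_integral_cong) (simp_all add: sum_distrib_left exp_sum fin prod_ennreal mult.assoc)
  also have "\<dots> = (\<Prod>i\<in>I. \<integral>\<^sup>+\<omega>. ennreal (exp (l * w i * X i \<omega>)) \<partial>M)"
    by (intro indep_vars_nn_integral fin indep_vars_compose2[OF indep]) auto
  also have "\<dots> = (\<Prod>i\<in>I. ennreal (exp ((l * w i)\<^sup>2 * \<sigma>\<^sup>2 / 2)))"
    by (intro prod.cong refl normal_mgf[OF \<sigma>] normal)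
  also have "\<dots> = ennreal (exp (\<Sum>i\<in>I. (l * w i)\<^sup>2 * \<sigma>\<^sup>2 / 2))"
    by (simp add: prod_ennreal exp_sum fin)
  also have "(\<Sum>i\<in>I. (l * w i)\<^sup>2 * \<sigma>\<^sup>2 / 2) = l\<^sup>2 * \<sigma>\<^sup>2 / 2 * (\<Sum>i\<in>I. (w i)\<^sup>2)"
    by (simp add: sum_distrib_left power_mult_distrib mult_ac)
  also have "ennreal (exp (- l * u)) * ennreal (exp (l\<^sup>2 * \<sigma>\<^sup>2 / 2 * (\<Sum>i\<in>I. (w i)\<^sup>2)))
      = ennreal (exp (- l * u + l\<^sup>2 * \<sigma>\<^sup>2 / 2 * (\<Sum>i\<in>I. (w i)\<^sup>2)))"
    by (simp only: exp_add ennreal_mult[symmetric] exp_ge_zero)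
  finally have "prob {\<omega> \<in> space M. u \<le> (\<Sum>i\<in>I. w i * X i \<omega>)}
      \<le> exp (- l * u + l\<^sup>2 * \<sigma>\<^sup>2 / 2 * (\<Sum>i\<in>I. (w i)\<^sup>2))"
    by simp
  also have "\<dots> \<le> exp (- l * u + l\<^sup>2 * \<sigma>\<^sup>2 / 2 * v)"
    using v by (simp add: mult_left_mono)
  also have "- l * u + l\<^sup>2 * \<sigma>\<^sup>2 / 2 * v = - u\<^sup>2 / (2 * \<sigma>\<^sup>2 * v)"
    using v \<sigma> by (simp add: l_def power2_eq_square field_simps)
  finally show ?thesis .
qed

lemma gaussian_linear_form_tail:
  fixes X :: "nat \<Rightarrow> 'a \<Rightarrow> real" and w :: "nat \<Rightarrow> real"
  assumes fin: "finite I" and indep: "indep_vars (\<lambda>_. borel) X I" and \<sigma>: "0 < \<sigma>"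
    and normal: "\<And>i. i \<in> I \<Longrightarrow> distributed M lborel (X i) (normal_density 0 \<sigma>)"
    and v: "0 < v" "(\<Sum>i\<in>I. (w i)\<^sup>2) \<le> v" and u: "0 \<le> u"
  shows "prob {\<omega> \<in> space M. u < \<bar>\<Sum>i\<in>I. w i * X i \<omega>\<bar>} \<le> 2 * exp (- u\<^sup>2 / (2 * \<sigma>\<^sup>2 * v))"
proof (cases "u = 0")
  case True
  have "prob {\<omega> \<in> space M. u < \<bar>\<Sum>i\<in>I. w i * X i \<omega>\<bar>} \<le> 1" by simp
  also have "\<dots> \<le> 2 * exp (- u\<^sup>2 / (2 * \<sigma>\<^sup>2 * v))" using True by simp
  finally show ?thesis .
next
  case False
  with u have u': "0 < u" by simp
  have [measurable]: "X i \<in> borel_measurable M" if "i \<in> I" for i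
    using indep that by (auto simp: indep_vars_def2)
  have [measurable]: "(\<lambda>\<omega>. \<Sum>i\<in>I. w' i * X i \<omega>) \<in> borel_measurable M" for w' :: "nat \<Rightarrow> real"
    by (intro borel_measurable_sum borel_measurable_times) auto
  let ?P = "\<lambda>w'. {\<omega> \<in> space M. u \<le> (\<Sum>i\<in>I. w' i * X i \<omega>)}"
  have "prob {\<omega> \<in> space M. u < \<bar>\<Sum>i\<in>I. w i * X i \<omega>\<bar>} \<le> prob (?P w \<union> ?P (\<lambda>i. - w i))"
    by (intro finite_measure_mono) (auto simp: sum_negf abs_if split: if_splits)
  also have "\<dots> \<le> prob (?P w) + prob (?P (\<lambda>i. - w i))"
    by (intro measure_Un_le) measurable
  also have "\<dots> \<le> exp (- u\<^sup>2 / (2 * \<sigma>\<^sup>2 * v)) + exp (- u\<^sup>2 / (2 * \<sigma>\<^sup>2 * v))"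
    by (intro add_mono gaussian_linear_form_upper_tail[OF fin indep \<sigma> normal v(1) _ u'])
       (use v(2) in auto)
  finally show ?thesis by simp
qed

end

text \<open>
  A single column of the design is the image of a unit vector supported on one group.
\<close>

lemma design_column_le:
  assumes src: "sparse_riesz G" and n: "1 \<le> nobs G" and rank: "1 \<le> rank_src G"
    and kj: "(k, j) \<in> coeff_index G {1..ngrp G}"
  shows "(\<Sum>i\<in>{1..nobs G}. (design G i k j)\<^sup>2) \<le> real (nobs G) * spec_hi G"
proof -
  define v where "v = (\<lambda>k' j'. if k' = k \<and> j' = j then 1 else (0::real))"
  have k: "k \<in> {1..ngrp G}" and j: "j \<in> {1..gdim G k}" using kj by (auto simp: coeff_index_def)
  have hi: "0 \<le> real (nobs G) * spec_hi G" using src by (auto simp: sparse_riesz_def)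
  have "lin_map G {k} v i = design G i k j" for i
    using j by (simp add: lin_map_def v_def if_distrib[of "\<lambda>x. design G i k _ * x"] sum.delta' cong: if_cong)
  then have lin: "lin_map G {k} v = (\<lambda>i. design G i k j)" by auto
  have "(coeff_norm G {k} v)\<^sup>2 = (\<Sum>j'\<in>{1..gdim G k}. if j' = j then 1 else 0)"
    unfolding coeff_norm_power2[OF finite.insertI[OF finite.emptyI]] by (simp add: block_norm_power2 v_def if_distrib[of "\<lambda>x. x\<^sup>2"] cong: if_cong)
  also have "\<dots> = 1" using j by (subst sum.delta) auto
  finally have "coeff_norm G {k} v = 1" using coeff_norm_nonneg[of G "{k}" v]
    by (simp add: power2_eq_1_iff)
  moreover have "obs_norm G (lin_map G {k} v) \<le> sqrt (real (nobs G) * spec_hi G) * coeff_norm G {k} v"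
    using k rank by (intro src_upper_bound[OF src n]) auto
  ultimately have "obs_norm G (\<lambda>i. design G i k j) \<le> sqrt (real (nobs G) * spec_hi G)"
    by (simp add: lin)
  then have "(obs_norm G (\<lambda>i. design G i k j))\<^sup>2 \<le> (sqrt (real (nobs G) * spec_hi G))\<^sup>2"
    by (intro power_mono obs_norm_nonneg)
  then show ?thesis using hi by (simp add: obs_norm_power2)
qed

text \<open>
  Each column correlation is centred normal with standard deviation at most \<open>\<sigma> \<surd>(n c\<^sup>*)\<close>, and there
  are at most \<open>p d\<^sub>a\<close> columns for the union bound.
\<close>

lemma (in prob_space) noise_level_prob:
  fixes G :: grouped_model and \<epsilon> :: "nat \<Rightarrow> 'a \<Rightarrow> real"
  assumes src: "sparse_riesz G" and n: "1 \<le> nobs G" and rank: "1 \<le> rank_src G"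
    and indep: "indep_vars (\<lambda>_. borel) \<epsilon> {1..nobs G}" and \<sigma>: "0 < \<sigma>"
    and normal: "\<And>i. i \<in> {1..nobs G} \<Longrightarrow> distributed M lborel (\<epsilon> i) (normal_density 0 \<sigma>)"
    and L: "0 \<le> L"
  defines "Good \<equiv> {\<omega> \<in> space M. \<forall>(k, j)\<in>coeff_index G {1..ngrp G}.
      \<bar>\<Sum>i\<in>{1..nobs G}. design G i k j * \<epsilon> i \<omega>\<bar> \<le> \<sigma> * sqrt (2 * (real (nobs G) * spec_hi G) * L)}"
  shows "Good \<in> sets M" and "1 - 2 * (real (ngrp G) * real (dim_a G)) * exp (- L) \<le> prob Good"
proof -
  let ?J = "coeff_index G {1..ngrp G}" and ?v = "real (nobs G) * spec_hi G"
  let ?u = "\<sigma> * sqrt (2 * ?v * L)"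
  define Bad where "Bad kj = {\<omega> \<in> space M. ?u < \<bar>\<Sum>i\<in>{1..nobs G}. design G i (fst kj) (snd kj) * \<epsilon> i \<omega>\<bar>}" for kj
  have v: "0 < ?v" using src n by (auto simp: sparse_riesz_def)
  have finJ: "finite ?J" by (simp add: coeff_index_def)
  have [measurable]: "\<epsilon> i \<in> borel_measurable M" if "i \<in> {1..nobs G}" for i
    using indep that by (auto simp: indep_vars_def2)
  have [measurable]: "(\<lambda>\<omega>. \<Sum>i\<in>{1..nobs G}. design G i k j * \<epsilon> i \<omega>) \<in> borel_measurable M" for k j
    by (intro borel_measurable_sum borel_measurable_times) auto
  have Bad_sets: "Bad kj \<in> sets M" for kj unfolding Bad_def by measurable
  have Good: "Good = space M - (\<Union>kj\<in>?J. Bad kj)"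
    unfolding Good_def Bad_def by (fastforce simp: not_less[symmetric])
  show "Good \<in> sets M" unfolding Good using finJ Bad_sets by auto
  have "prob (Bad kj) \<le> 2 * exp (- L)" if "kj \<in> ?J" for kj
  proof -
    have "prob (Bad kj) \<le> 2 * exp (- ?u\<^sup>2 / (2 * \<sigma>\<^sup>2 * ?v))"
      unfolding Bad_def using that v L \<sigma>
      by (intro gaussian_linear_form_tail indep normal design_column_le[OF src n rank]) auto
    also have "?u\<^sup>2 = \<sigma>\<^sup>2 * (2 * ?v * L)" using v L by (simp add: power_mult_distrib)
    also have "- (\<sigma>\<^sup>2 * (2 * ?v * L)) / (2 * \<sigma>\<^sup>2 * ?v) = - L"
      using less_imp_neq[OF v] \<sigma> by (simp del: mult_eq_0_iff)
    finally show ?thesis .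
  qed
  then have "(\<Sum>kj\<in>?J. prob (Bad kj)) \<le> (\<Sum>kj\<in>?J. 2 * exp (- L))" by (rule sum_mono)
  also have "\<dots> = real (card ?J) * (2 * exp (- L))" by simp
  also have "\<dots> \<le> real (ngrp G * dim_a G) * (2 * exp (- L))"
  proof (intro mult_right_mono of_nat_mono)
    have "card ?J = (\<Sum>k\<in>{1..ngrp G}. gdim G k)" by (simp add: coeff_index_def)
    also have "\<dots> \<le> (\<Sum>k\<in>{1..ngrp G}. dim_a G)" by (intro sum_mono gdim_le_dim_a)
    finally show "card ?J \<le> ngrp G * dim_a G" by simp
  qed simp
  finally have "(\<Sum>kj\<in>?J. prob (Bad kj)) \<le> 2 * (real (ngrp G) * real (dim_a G)) * exp (- L)" by simp
  moreover have "prob (\<Union>kj\<in>?J. Bad kj) \<le> (\<Sum>kj\<in>?J. prob (Bad kj))"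
    using finJ Bad_sets by (intro finite_measure_subadditive_finite) auto
  moreover have "prob Good = 1 - prob (\<Union>kj\<in>?J. Bad kj)"
    unfolding Good using finJ Bad_sets by (intro prob_compl) auto
  ultimately show "1 - 2 * (real (ngrp G) * real (dim_a G)) * exp (- L) \<le> prob Good" by simp
qed

section \<open>The penalty level\<close>

lemma M1_antimono:
  assumes src: "sparse_riesz G" and sparse: "generalized_sparsity G" and lam: "0 < mu" "mu \<le> lam"
    and d: "1 \<le> dim_b G" and q: "1 \<le> nlarge G"
  shows "M1 G lam \<le> M1 G mu"
proof -
  have hi: "0 < spec_hi G" "0 \<le> eta1 G" "0 \<le> spec_ratio G" "0 \<le> dim_ratio G"
    using src sparse by (auto simp: sparse_riesz_def generalized_sparsity_def spec_ratio_def dim_ratio_def)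
  have "r1 G lam \<le> r1 G mu"
    unfolding r1_def using hi lam d q
    by (intro real_sqrt_le_mono divide_left_mono mult_right_mono mult_nonneg_nonneg mult_pos_pos) auto
  moreover have "0 \<le> r1 G lam"
    unfolding r1_def using hi lam by (auto intro!: divide_nonneg_nonneg mult_nonneg_nonneg)
  ultimately have "(r1 G lam)\<^sup>2 \<le> (r1 G mu)\<^sup>2" by (rule power_mono)
  moreover have "r2 G lam \<le> r2 G mu"
    unfolding r2_def using hi lam d q
    by (intro real_sqrt_le_mono divide_left_mono mult_right_mono mult_nonneg_nonneg mult_pos_pos power_mono) auto
  then have "sqrt (dim_ratio G * spec_ratio G) * r2 G lam \<le> sqrt (dim_ratio G * spec_ratio G) * r2 G mu"
    using hi by (intro mult_left_mono) auto
  ultimately show ?thesis unfolding M1_def by simp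
qed

text \<open>
  \<open>M\<^sub>1\<close> is decreasing, so the rank condition holds at every penalty level above \<open>\<lambda>\<^sub>0\<close>.  If \<open>\<lambda>\<close> equals
  \<open>\<lambda>\<^sub>0\<close>, it follows in the limit from above, because \<open>M\<^sub>1\<close> is continuous at positive levels.
\<close>

lemma rank_bound_above_lambda_0:
  assumes src: "sparse_riesz G" and sparse: "generalized_sparsity G"
    and d: "1 \<le> dim_b G" and q: "1 \<le> nlarge G"
    and lam: "0 < lam" "lambda_0 G \<le> ereal lam"
  shows "M1 G lam * real (nlarge G) + 1 \<le> real (rank_src G)"
proof (rule tendsto_upperbound)
  have "isCont (\<lambda>l. M1 G l * real (nlarge G) + 1) lam"
    unfolding M1_def r1_def r2_def using lam d q by (intro continuous_intros) auto
  then show "((\<lambda>l. M1 G l * real (nlarge G) + 1) \<longlongrightarrow> M1 G lam * real (nlarge G) + 1) (at_right lam)"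
    by (simp add: isCont_def filterlim_at_split)
  show "\<forall>\<^sub>F l in at_right lam. M1 G l * real (nlarge G) + 1 \<le> real (rank_src G)"
    using eventually_at_right_less[of lam]
  proof eventually_elim
    case (elim l)
    then have "lambda_0 G < ereal l" using lam(2) by (simp add: order_le_less_trans)
    then obtain mu where mu: "0 < mu" "M1 G mu * real (nlarge G) + 1 \<le> real (rank_src G)" "mu < l"
      unfolding lambda_0_def Inf_less_iff by auto
    have "M1 G l * real (nlarge G) \<le> M1 G mu * real (nlarge G)"
      using mu by (intro mult_right_mono M1_antimono[OF src sparse _ _ d q]) auto
    with mu(2) show ?case by simp
  qed
qed simp

text \<open>
  A finite penalty level above \<open>\<lambda>\<^sub>0\<close> shows that some level satisfies the rank condition.  Positivity of
  \<open>q\<^sup>*\<close> makes \<open>\<lambda>\<^sub>n\<^sub>,\<^sub>p\<close>, and hence \<open>\<lambda>\<close>, positive; only then can the rank condition be used at \<open>\<lambda>\<close>.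
\<close>

lemma rank_pos_of_lambda_0_finite:
  assumes src: "sparse_riesz G" and D: "0 \<le> dim_ratio G * spec_ratio G"
    and lam: "lambda_0 G \<le> ereal lam"
  shows "1 \<le> rank_src G"
proof -
  have "lambda_0 G < ereal (lam + 1)" using lam by (simp add: order_le_less_trans)
  then obtain mu where mu: "M1 G mu * real (nlarge G) + 1 \<le> real (rank_src G)"
    unfolding lambda_0_def Inf_less_iff by auto
  have "0 \<le> M1 G mu" using M1_ge[OF src D, of mu] D zero_le_power2[of "r1 G mu"] by linarith
  then have "0 \<le> M1 G mu * real (nlarge G)" by simp
  with mu show ?thesis by linarith
qed

text \<open>
  The factor \<open>q\<^sup>*\<close> under the root of \<open>\<lambda>\<^sub>n\<^sub>,\<^sub>p\<close> makes the noise small against the penalty: with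
  \<open>q\<^sup>* \<ge> 7\<close> one has \<open>4 \<cdot> 8 \<cdot> q\<^sup>* \<ge> 224 \<ge> 10\<^sup>2 \<cdot> 2\<close>.
\<close>

lemma noise_level_le_penalty:
  assumes \<sigma>: "0 < \<sigma>" and c0: "0 \<le> c0" and L: "0 \<le> ln (max (real (dim_total G)) a)"
    and da: "1 \<le> dim_a G" and d: "1 \<le> dim_ratio G" and cbar: "1 \<le> spec_ratio G"
    and rank: "7 \<le> rank_src G" and hi: "0 \<le> spec_hi G"
    and lam: "lambda_np G \<sigma> c0 a \<le> lam"
  shows "\<sigma> * sqrt (2 * (real (nobs G) * spec_hi G) * ((1 + c0) * ln (max (real (dim_total G)) a))) \<le> lam / 10"
proof -
  define w where "w = real (nobs G) * spec_hi G * ((1 + c0) * ln (max (real (dim_total G)) a))"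
  have w: "0 \<le> w" using hi c0 L by (simp add: w_def)
  have "1 * 1 * 7 * 1 \<le> real (dim_a G) * (dim_ratio G)\<^sup>2 * real (rank_src G) * spec_ratio G"
    using da d cbar rank by (intro mult_mono mult_nonneg_nonneg) (auto simp: one_le_power)
  then have "8 * (7 * w) \<le> 8 * (real (dim_a G) * (dim_ratio G)\<^sup>2 * real (rank_src G) * spec_ratio G * w)"
    using w by (intro mult_left_mono mult_right_mono) auto
  moreover have "lambda_np G \<sigma> c0 a
      = 2 * \<sigma> * sqrt (8 * (real (dim_a G) * (dim_ratio G)\<^sup>2 * real (rank_src G) * spec_ratio G * w))"
    by (simp add: lambda_np_def w_def mult_ac)
  ultimately have "2 * \<sigma> * sqrt (8 * (7 * w)) \<le> lam"
    using lam \<sigma> by (smt (verit, best) mult_left_mono real_sqrt_le_mono)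
  moreover have "10 * (\<sigma> * sqrt (2 * w)) \<le> 2 * \<sigma> * sqrt (8 * (7 * w))"
  proof -
    have "sqrt 25 = (5::real)" by (rule real_sqrt_unique) auto
    then have "5 * sqrt (2 * w) = sqrt (25 * (2 * w))"
      by (simp only: real_sqrt_mult[of 25 "2 * w"])
    also have "\<dots> \<le> sqrt (8 * (7 * w))" using w by (intro real_sqrt_le_mono) simp
    finally show ?thesis using \<sigma> by simp
  qed
  ultimately show ?thesis by (simp add: w_def mult_ac)
qed

text \<open>
  As \<open>D = d c\<^sup>* / c\<^sub>* \<ge> 1\<close>, one has \<open>4 (r\<^sub>1\<^sup>2 + D) \<le> M\<^sub>1 \<le> D M\<^sub>1\<close>; moreover \<open>d\<^sub>b \<le> d\<^sub>b\<^sup>2\<close>.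
\<close>

lemma error_radius_le:
  assumes src: "sparse_riesz G" and D: "1 \<le> dim_ratio G * spec_ratio G"
    and db: "1 \<le> dim_b G" and lam: "0 \<le> lam"
  shows "2 * sqrt ((r1 G lam)\<^sup>2 + dim_ratio G * spec_ratio G)
       * (lam * sqrt (real (dim_b G) * real (nlarge G) / (real (nobs G) * spec_hi G)))
     \<le> sqrt (dim_ratio G * M1 G lam * spec_ratio G) * B1 G lam"
proof (rule mult_mono)
  let ?D = "dim_ratio G * spec_ratio G"
  have "4 * ((r1 G lam)\<^sup>2 + ?D) \<le> 1 * M1 G lam" using M1_ge[OF src, of lam] D by simp
  also have "\<dots> \<le> ?D * M1 G lam"
    using D M1_ge[OF src, of lam] by (intro mult_right_mono) (auto intro: order_trans[rotated])
  finally have "sqrt (4 * ((r1 G lam)\<^sup>2 + ?D)) \<le> sqrt (dim_ratio G * M1 G lam * spec_ratio G)"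
    by (intro real_sqrt_le_mono) (simp add: mult_ac)
  then show "2 * sqrt ((r1 G lam)\<^sup>2 + ?D) \<le> sqrt (dim_ratio G * M1 G lam * spec_ratio G)"
    unfolding real_sqrt_mult[of 4] real_sqrt_four .
  have hi: "0 < spec_hi G" using src by (auto simp: sparse_riesz_def)
  have "lam * sqrt (real (dim_b G) * real (nlarge G) / (real (nobs G) * spec_hi G))
     = sqrt (lam\<^sup>2 * (real (dim_b G) * real (nlarge G) / (real (nobs G) * spec_hi G)))"
    unfolding real_sqrt_mult[of "lam\<^sup>2"] using lam by simp
  also have "\<dots> \<le> sqrt (lam\<^sup>2 * ((real (dim_b G))\<^sup>2 * real (nlarge G) / (real (nobs G) * spec_hi G)))"
    using db hi by (intro real_sqrt_le_mono mult_left_mono divide_right_mono mult_right_mono) (auto simp: power2_eq_square)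
  also have "\<dots> = B1 G lam" by (simp add: B1_def mult.assoc)
  finally show "lam * sqrt (real (dim_b G) * real (nlarge G) / (real (nobs G) * spec_hi G)) \<le> B1 G lam" .
  show "0 \<le> sqrt (dim_ratio G * M1 G lam * spec_ratio G)"
  proof -
    have "0 \<le> M1 G lam" using M1_ge[OF src, of lam] D zero_le_power2[of "r1 G lam"] by linarith
    then have "0 \<le> ?D * M1 G lam" by (rule mult_nonneg_nonneg[rotated]) (use D in linarith)
    then show ?thesis by (simp add: mult_ac)
  qed
  show "0 \<le> lam * sqrt (real (dim_b G) * real (nlarge G) / (real (nobs G) * spec_hi G))"
    using lam hi by simp
qed

lemma dim_total_ge:
  assumes "\<And>k. k \<in> {1..ngrp G} \<Longrightarrow> 1 \<le> gdim G k"
  shows "ngrp G \<le> dim_total G"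
proof -
  have "(\<Sum>k\<in>{1..ngrp G}. 1) \<le> dim_total G"
    unfolding dim_total_def by (intro sum_mono assms)
  then show ?thesis by simp
qed

section \<open>Measurability of the error norms\<close>

lemma measurable_coeff_norm:
  assumes "\<And>k j. (k, j) \<in> coeff_index G A \<Longrightarrow> (\<lambda>\<omega>. f \<omega> k j) \<in> borel_measurable M"
  shows "(\<lambda>\<omega>. coeff_norm G A (\<lambda>k j. f \<omega> k j)) \<in> borel_measurable M"
  unfolding coeff_norm_def L2_set_def case_prod_beta
  by (intro measurable_compose[OF _ borel_measurable_sqrt] borel_measurable_sum
      borel_measurable_power assms) auto

lemma measurable_lin_map:
  assumes "\<And>k j. (k, j) \<in> coeff_index G A \<Longrightarrow> (\<lambda>\<omega>. f \<omega> k j) \<in> borel_measurable M"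
  shows "(\<lambda>\<omega>. lin_map G A (f \<omega>) i) \<in> borel_measurable M"
  unfolding lin_map_def
  by (intro borel_measurable_sum borel_measurable_times borel_measurable_const assms)
     (simp add: coeff_index_def)

lemma measurable_obs_norm:
  assumes "\<And>i. (\<lambda>\<omega>. f \<omega> i) \<in> borel_measurable M"
  shows "(\<lambda>\<omega>. obs_norm G (f \<omega>)) \<in> borel_measurable M"
  unfolding obs_norm_def L2_set_def
  by (intro measurable_compose[OF _ borel_measurable_sqrt] borel_measurable_sum
      borel_measurable_power assms)

section \<open>Error bounds in probability\<close>

theorem theorem2p2:
  fixes \<sigma> c0 cbar d \<rho>1 \<rho>2 :: real
    and G :: "nat \<Rightarrow> grouped_model"
    and a lam :: "nat \<Rightarrow> real"
    and M :: "nat \<Rightarrow> 'w measure"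
    and \<epsilon> :: "nat \<Rightarrow> nat \<Rightarrow> 'w \<Rightarrow> real"
    and Y :: "nat \<Rightarrow> 'w \<Rightarrow> nat \<Rightarrow> real"
    and betahat :: "nat \<Rightarrow> 'w \<Rightarrow> nat \<Rightarrow> nat \<Rightarrow> real"
  assumes prob: "\<And>m. prob_space (M m)"
    and sigma: "0 < \<sigma>"
    and eps_indep: "\<And>m. prob_space.indep_vars (M m) (\<lambda>_. borel) (\<epsilon> m) {1..nobs (G m)}"
    and eps_normal: "\<And>m i. i \<in> {1..nobs (G m)} \<Longrightarrow>
           distributed (M m) lborel (\<epsilon> m i) (normal_density 0 \<sigma>)"
    and linear_model: "\<And>m \<omega> i. \<omega> \<in> space (M m) \<Longrightarrow> i \<in> {1..nobs (G m)} \<Longrightarrow>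
           Y m \<omega> i = lin_map (G m) {1..ngrp (G m)} (coeff_true (G m)) i + \<epsilon> m i \<omega>"
    and gdim_pos: "\<And>m k. k \<in> {1..ngrp (G m)} \<Longrightarrow> 1 \<le> gdim (G m) k"
    and fixed_cbar: "\<And>m. spec_ratio (G m) = cbar"
    and fixed_d: "\<And>m. dim_ratio (G m) = d"
    and fixed_r1: "\<And>m. r1 (G m) (lam m) = \<rho>1"
    and fixed_r2: "\<And>m. r2 (G m) (lam m) = \<rho>2"
    and sizes: "\<And>m. 1 \<le> nlarge (G m) \<and> nlarge (G m) \<le> nobs (G m) \<and> nobs (G m) \<le> ngrp (G m)"
    and p_infinity: "filterlim (\<lambda>m. ngrp (G m)) at_top sequentially"
    and sparsity: "\<And>m. generalized_sparsity (G m)"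
    and src: "\<And>m. sparse_riesz (G m)"
    and c0_nonneg: "0 \<le> c0"
    and a_nonneg: "\<And>m. 0 \<le> a m"
    and a_c0: "(\<lambda>m. real (ngrp (G m)) * real (dim_a (G m))
                     / max (real (dim_total (G m))) (a m) powr (1 + c0)) \<longlonglongrightarrow> 0"
    and penalty: "\<And>m. ereal (lam m) \<ge> max (lambda_0 (G m)) (ereal (lambda_np (G m) \<sigma> c0 (a m)))"
    and betahat_measurable: "\<And>m k j. (k, j) \<in> coeff_index (G m) {1..ngrp (G m)} \<Longrightarrow>
           (\<lambda>\<omega>. betahat m \<omega> k j) \<in> borel_measurable (M m)"
    and betahat: "\<And>m \<omega>. \<omega> \<in> space (M m) \<Longrightarrow> is_group_lasso (G m) (lam m) (Y m \<omega>) (betahat m \<omega>)"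
  shows "(\<lambda>m. measure (M m) {\<omega> \<in> space (M m).
           coeff_norm (G m) {1..ngrp (G m)} (\<lambda>k j. betahat m \<omega> k j - coeff_true (G m) k j)
             \<le> 1 / sqrt (real (nobs (G m)) * spec_lo (G m))
                 * (2 * \<sigma> * sqrt (M1 (G m) (lam m) * ln (real (dim_total (G m))) * real (nlarge (G m)))
                    + (\<rho>2 + sqrt (d * M1 (G m) (lam m) * cbar)) * B1 (G m) (lam m))
               + sqrt ((spec_lo (G m) * \<rho>1\<^sup>2 + \<rho>2\<^sup>2) / (spec_lo (G m) * spec_hi (G m)))
                 * (sqrt (real (nlarge (G m))) * lam m / real (nobs (G m)))
         \<and> obs_norm (G m) (\<lambda>i. lin_map (G m) {1..ngrp (G m)} (betahat m \<omega>) i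
                               - lin_map (G m) {1..ngrp (G m)} (coeff_true (G m)) i)
             \<le> 2 * \<sigma> * sqrt (M1 (G m) (lam m) * ln (real (dim_total (G m))) * real (nlarge (G m)))
               + (2 * \<rho>2 + sqrt (d * M1 (G m) (lam m) * cbar)) * B1 (G m) (lam m)})
         \<longlonglongrightarrow> 1"
proof -
  let ?N = "\<lambda>m. {1..ngrp (G m)}" and ?\<beta> = "\<lambda>m. coeff_true (G m)"
  let ?S = "\<lambda>m. 2 * \<sigma> * sqrt (M1 (G m) (lam m) * ln (real (dim_total (G m))) * real (nlarge (G m)))"
  let ?T = "\<lambda>m. sqrt (d * M1 (G m) (lam m) * cbar)"
  let ?C = "\<lambda>m. 1 / sqrt (real (nobs (G m)) * spec_lo (G m)) * (?S m + (\<rho>2 + ?T m) * B1 (G m) (lam m))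
      + sqrt ((spec_lo (G m) * \<rho>1\<^sup>2 + \<rho>2\<^sup>2) / (spec_lo (G m) * spec_hi (G m)))
        * (sqrt (real (nlarge (G m))) * lam m / real (nobs (G m)))"
  let ?P = "\<lambda>m. ?S m + (2 * \<rho>2 + ?T m) * B1 (G m) (lam m)"
  define Ev where "Ev m = {\<omega> \<in> space (M m).
       coeff_norm (G m) (?N m) (\<lambda>k j. betahat m \<omega> k j - ?\<beta> m k j) \<le> ?C m
     \<and> obs_norm (G m) (\<lambda>i. lin_map (G m) (?N m) (betahat m \<omega>) i - lin_map (G m) (?N m) (?\<beta> m) i) \<le> ?P m}" for m
  define rate where "rate m = real (ngrp (G m)) * real (dim_a (G m))
                     / max (real (dim_total (G m))) (a m) powr (1 + c0)" for m
  have Ev_sets: "Ev m \<in> sets (M m)" for m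
  proof -
    have [measurable]: "(\<lambda>\<omega>. coeff_norm (G m) (?N m) (\<lambda>k j. betahat m \<omega> k j - ?\<beta> m k j)) \<in> borel_measurable (M m)"
      by (intro measurable_coeff_norm borel_measurable_diff betahat_measurable) auto
    have [measurable]: "(\<lambda>\<omega>. obs_norm (G m) (\<lambda>i. lin_map (G m) (?N m) (betahat m \<omega>) i
          - lin_map (G m) (?N m) (?\<beta> m) i)) \<in> borel_measurable (M m)"
      by (intro measurable_obs_norm borel_measurable_diff measurable_lin_map betahat_measurable
          borel_measurable_const)
    show ?thesis unfolding Ev_def by measurable
  qed
  have lower: "1 - 2 * rate m \<le> measure (M m) (Ev m)" if p2: "2 \<le> ngrp (G m)" for m
  proof -
    interpret prob_space "M m" by (rule prob)
    have sz: "1 \<le> nlarge (G m)" "nlarge (G m) \<le> ngrp (G m)" "1 \<le> nobs (G m)" "1 \<le> ngrp (G m)"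
      using sizes[of m] by auto
    have db: "1 \<le> dim_b (G m)" using dim_b_pos[of "G m", OF sz(4) gdim_pos] .
    have da: "1 \<le> dim_a (G m)" using db dim_b_le_dim_a[OF sz(4)] by simp
    have ratio: "1 \<le> dim_ratio (G m)" "1 < spec_ratio (G m)"
      using dim_ratio_ge_1[OF sz(4) gdim_pos] spec_ratio_gt_1[OF src] by auto
    have D: "1 \<le> dim_ratio (G m) * spec_ratio (G m)"
      using mult_mono[of 1 "dim_ratio (G m)" 1 "spec_ratio (G m)"] ratio by simp
    have spec: "0 < spec_lo (G m)" "0 < spec_hi (G m)" using src[of m] by (auto simp: sparse_riesz_def)
    define Q where "Q = max (real (dim_total (G m))) (a m)"
    have total: "2 \<le> real (dim_total (G m))" using dim_total_ge[of "G m", OF gdim_pos] p2 by simp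
    then have Q: "2 \<le> Q" by (simp add: Q_def)
    have lam_np: "lambda_np (G m) \<sigma> c0 (a m) \<le> lam m" and lam_0: "lambda_0 (G m) \<le> ereal (lam m)"
      using penalty[of m] by auto
    have M1_lower: "6 \<le> M1 (G m) (lam m)"
      using M1_ge[OF src[of m], of "lam m"] D zero_le_power2[of "r1 (G m) (lam m)"] by linarith
    have "1 \<le> rank_src (G m)"
      by (rule rank_pos_of_lambda_0_finite[OF src _ lam_0]) (use D in simp)
    then have "0 < lambda_np (G m) \<sigma> c0 (a m)"
      using sigma c0_nonneg ratio spec Q da sz unfolding lambda_np_def Q_def[symmetric]
      by (intro mult_pos_pos real_sqrt_gt_zero) auto
    with lam_np have rank0: "0 < lam m" by simp
    have rank: "M1 (G m) (lam m) * real (nlarge (G m)) + 1 \<le> real (rank_src (G m))"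
      by (rule rank_bound_above_lambda_0[OF src sparsity db sz(1) rank0 lam_0])
    have "6 * 1 \<le> M1 (G m) (lam m) * real (nlarge (G m))"
      using M1_lower sz by (intro mult_mono) auto
    with rank have rank7: "7 \<le> rank_src (G m)" by linarith
    define L where "L = (1 + c0) * ln Q"
    have L: "0 \<le> L" using c0_nonneg Q by (simp add: L_def)
    \<comment> \<open>With this \<open>L\<close> the union bound has exactly the order of the null sequence in the assumption on \<open>c\<^sub>0\<close>.\<close>
    define Good where "Good = {\<omega> \<in> space (M m). \<forall>(k, j)\<in>coeff_index (G m) (?N m).
      \<bar>\<Sum>i\<in>{1..nobs (G m)}. design (G m) i k j * \<epsilon> m i \<omega>\<bar>
        \<le> \<sigma> * sqrt (2 * (real (nobs (G m)) * spec_hi (G m)) * L)}"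
    have "exp (- L) = inverse (Q powr (1 + c0))"
      using Q by (simp add: L_def powr_def exp_minus)
    then have "1 - 2 * rate m = 1 - 2 * (real (ngrp (G m)) * real (dim_a (G m))) * exp (- L)"
      by (simp add: rate_def Q_def divide_inverse)
    also have "\<dots> \<le> prob Good"
      unfolding Good_def using rank7
      by (intro noise_level_prob(2) src sz eps_indep sigma eps_normal L) auto
    also have "prob Good \<le> prob (Ev m)"
    proof (rule finite_measure_mono[OF _ Ev_sets], rule subsetI)
      fix \<omega> assume \<omega>: "\<omega> \<in> Good"
      then have sp: "\<omega> \<in> space (M m)" by (simp add: Good_def)
      let ?h = "\<lambda>k j. betahat m \<omega> k j - ?\<beta> m k j"
      have level: "\<sigma> * sqrt (2 * (real (nobs (G m)) * spec_hi (G m)) * L) \<le> lam m / 10"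
        unfolding L_def Q_def
        using Q ratio spec
        by (intro noise_level_le_penalty sigma c0_nonneg da rank7 lam_np) (auto simp: Q_def)
      have noise: "\<bar>\<Sum>i\<in>{1..nobs (G m)}. design (G m) i k j * \<epsilon> m i \<omega>\<bar> \<le> lam m / 10"
        if "(k, j) \<in> coeff_index (G m) (?N m)" for k j
        using \<omega> that level unfolding Good_def by fastforce
      note bounds = group_lasso_error_bounds[OF src sz(1,2,3) gdim_pos sparsity rank0 rank
          betahat[OF sp] linear_model[OF sp] noise]
      have "2 * sqrt ((r1 (G m) (lam m))\<^sup>2 + dim_ratio (G m) * spec_ratio (G m))
         * (lam m * sqrt (real (dim_b (G m)) * real (nlarge (G m)) / (real (nobs (G m)) * spec_hi (G m))))
         \<le> ?T m * B1 (G m) (lam m)"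
        using error_radius_le[OF src D db, of "lam m"] rank0 by (simp add: fixed_d fixed_cbar)
      then have est: "sqrt (real (nobs (G m)) * spec_lo (G m)) * coeff_norm (G m) (?N m) ?h \<le> ?T m * B1 (G m) (lam m)"
        and pred: "obs_norm (G m) (lin_map (G m) (?N m) ?h) \<le> ?T m * B1 (G m) (lam m)"
        using bounds by (blast intro: order_trans)+
      have S0: "0 \<le> ?S m" using sigma M1_lower total by (intro mult_nonneg_nonneg) auto
      have B0: "0 \<le> B1 (G m) (lam m)" using spec by (simp add: B1_def)
      have \<rho>2: "0 \<le> \<rho>2" using r2_nonneg[OF src, of m "lam m"] by (simp add: fixed_r2)
      have \<rho>B: "0 \<le> \<rho>2 * B1 (G m) (lam m)" using \<rho>2 B0 by simp
      have sq: "0 < sqrt (real (nobs (G m)) * spec_lo (G m))" using spec sz by simp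
      have "coeff_norm (G m) (?N m) ?h
          \<le> 1 / sqrt (real (nobs (G m)) * spec_lo (G m)) * (?T m * B1 (G m) (lam m))"
        using est sq by (simp add: field_simps)
      also have "\<dots> \<le> 1 / sqrt (real (nobs (G m)) * spec_lo (G m)) * (?S m + (\<rho>2 + ?T m) * B1 (G m) (lam m))"
        using S0 \<rho>B sq by (intro mult_left_mono) (auto simp: distrib_right)
      also have "\<dots> \<le> ?C m"
        using spec rank0 by simp
      finally have "coeff_norm (G m) (?N m) ?h \<le> ?C m" .
      moreover have "obs_norm (G m) (\<lambda>i. lin_map (G m) (?N m) (betahat m \<omega>) i - lin_map (G m) (?N m) (?\<beta> m) i) \<le> ?P m"
        using pred S0 \<rho>B unfolding lin_map_diff by (simp add: distrib_right)
      ultimately show "\<omega> \<in> Ev m" using sp by (simp add: Ev_def)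
    qed
    finally show ?thesis .
  qed
  have "(\<lambda>m. measure (M m) (Ev m)) \<longlonglongrightarrow> 1"
  proof (rule tendsto_sandwich)
    have "(\<lambda>m. 1 - 2 * rate m) \<longlonglongrightarrow> 1 - 2 * 0"
      using a_c0 unfolding rate_def by (intro tendsto_intros)
    then show "(\<lambda>m. 1 - 2 * rate m) \<longlonglongrightarrow> 1" by simp
    have "\<forall>\<^sub>F m in sequentially. 2 \<le> ngrp (G m)"
      using p_infinity by (simp add: filterlim_at_top)
    then show "\<forall>\<^sub>F m in sequentially. 1 - 2 * rate m \<le> measure (M m) (Ev m)"
      by eventually_elim (rule lower)
    show "\<forall>\<^sub>F m in sequentially. measure (M m) (Ev m) \<le> 1"
      by (intro always_eventually allI prob_space.prob_le_1 prob)
  qed simp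
  then show ?thesis unfolding Ev_def .
qed

end
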